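(* Let $n\ge1$ be a given degree. For $\omega\in(0,(n+1)\pi)$ the poles of the unitary best approximation $r_\omega\in\mathcal{U}_n$ to $\mathrm{e}^{\mathrm{i}\omega x}$ depend continuously on $\omega$.
   Context: For a complex polynomial $p$ let $p^\dag(z):=\overline{p}(-z)=\overline{p(-\overline z)}$, where $\overline p$ has complex-conjugated coefficients. Let $\mathcal{U}_n:=\{p^\dag/p : p \text{ a complex polynomial of degree}\le n,\ p\not\equiv 0\}$, with rational functions identified with their irreducible form; then $|r(\mathrm{i}x)|=1$ for $r\in\mathcal{U}_n$, $x\in\mathbb{R}$. For $r\in\mathcal{U}_n$, $\|r-\exp(\omega\cdot)\|:=\max_{x\in[-1,1]}|r(\mathrm{i}x)-\mathrm{e}^{\mathrm{i}\omega x}|$. For $\omega\in(0,(n+1)\pi)$ the unitary best approximation $r_\omega$ is the (existing and unique) element of $\mathcal{U}_n$ with $\|r_\omega-\exp(\omega\cdot)\|=\min_{u\in\mathcal{U}_n}\|u-\exp(\omega\cdot)\|$; it has exactly $n$ distinct poles. Continuous dependence of the poles is understood up to ordering: whenever $\omega_k\to\omega_a$ with $\omega_k,\omega_a\in(0,(n+1)\pi)$, the poles of $r_{\omega_k}$ can be numbered so that they converge, one by one, to the poles of $r_{\omega_a}$. *)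

theory Defs
  imports
    "HOL-Complex_Analysis.Complex_Analysis"
    "HOL-Computational_Algebra.Computational_Algebra"
    "HOL-Computational_Algebra.Field_as_Ring"
begin

definition dagger :: "complex poly \<Rightarrow> complex poly" where
  "dagger p = pcompose (map_poly cnj p) [:0, -1:]"

lemma poly_dagger: "poly (dagger p) z = cnj (poly p (- cnj z))"
  by (simp add: dagger_def poly_pcompose)

text \<open>
  Rational functions are elements of the fraction field of the polynomials, so different
  representations of the same quotient are identified.
\<close>

definition unitary_rationals :: "nat \<Rightarrow> complex poly fract set" where
  "unitary_rationals n = {Fract (dagger p) p | p. degree p \<le> n \<and> p \<noteq> 0}"

text \<open>
  \<^const>\<open>quot_of_fract\<close> yields the coprime numerator/denominator pair, i.e. the irreducible
  form. Evaluating that form removes common zeros of \<open>p\<close> and \<open>dagger p\<close>; in particular an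
  element of \<^const>\<open>unitary_rationals\<close> has no singularity on the imaginary axis.
\<close>

definition rat_eval :: "complex poly fract \<Rightarrow> complex \<Rightarrow> complex" where
  "rat_eval r z = poly (fst (quot_of_fract r)) z / poly (snd (quot_of_fract r)) z"

definition poles :: "complex poly fract \<Rightarrow> complex set" where
  "poles r = {z. is_pole (rat_eval r) z}"

text \<open>
  For unitary \<open>r\<close> the error is continuous in \<open>x\<close>, so the supremum over the compact interval
  is the maximum.
\<close>

definition approx_error :: "real \<Rightarrow> complex poly fract \<Rightarrow> real" where
  "approx_error \<omega> r =
     (SUP x\<in>{-1..1::real}. cmod (rat_eval r (\<i> * of_real x) - exp (\<i> * of_real (\<omega> * x))))"

definition is_unitary_best_approx :: "nat \<Rightarrow> real \<Rightarrow> complex poly fract \<Rightarrow> bool" where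
  "is_unitary_best_approx n \<omega> r \<longleftrightarrow>
     r \<in> unitary_rationals n \<and> (\<forall>u\<in>unitary_rationals n. approx_error \<omega> r \<le> approx_error \<omega> u)"

text \<open>Existence and uniqueness hold for \<open>0 < \<omega> < (n + 1) * pi\<close>.\<close>

definition unitary_best_approx :: "nat \<Rightarrow> real \<Rightarrow> complex poly fract" where
  "unitary_best_approx n \<omega> = (THE r. is_unitary_best_approx n \<omega> r)"

end

theory Submission
  imports Defs
begin

text \<open>
  On the imaginary axis put \<open>W(x) = p(ix) exp(i \<omega> x / 2)\<close>. Since \<open>dagger p\<close> is the complex
  conjugate of \<open>p\<close> there, the pointwise error of \<open>r = dagger p / p\<close> is
  \<open>2 \<bar>Im W\<bar> / \<bar>W\<bar>\<close>: an error at most \<open>2 s\<close> means that \<open>W\<close> stays in the double cone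
  \<open>\<bar>Im W\<bar> \<le> s \<bar>W\<bar>\<close> (\<open>sine_bounded\<close>). This condition is homogeneous in \<open>p\<close>, closed under limits
  of coefficients, and, among those \<open>p\<close> with \<open>Re W > 0\<close>, convex. It turns the nonlinear
  approximation problem into a study of an optimal ray of polynomials; every step below is
  carried out for the denominator \<open>p\<close>.

  Normalising coefficients gives compactness and hence existence. For \<open>\<omega> < (n + 1) \<pi>\<close> the optimal
  error is below two: with \<open>v\<close> the polynomial vanishing at \<open>\<pi>, ..., n \<pi>\<close> the function
  \<open>v sin + c v' cos\<close> has a constant strict sign on a given compact part of \<open>(0, (n + 1) \<pi>)\<close> for
  small \<open>c > 0\<close>, and it is the real part of some \<open>W\<close> (\<open>positive_real_part_exists\<close>). Then \<open>Re W\<close> has a constant sign for the optimal \<open>p\<close>.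

  The key is a count of extremal points, where \<open>\<bar>Im W\<bar> = s \<bar>W\<bar>\<close>
  (\<open>optimal_extremal_count\<close>). Let \<open>p\<close> be coprime to \<open>dagger p\<close>, of degree \<open>m \<le> n\<close> with \<open>m'\<close> distinct
  zeros. If there were at most \<open>n + m + 1\<close> extremal points, a Bezout argument
  would produce a direction \<open>q\<close> in which the error decreases at all of them, so
  there are at least \<open>n + m + 2\<close>. On the other hand the interior extremal points are zeros of the
  derivative of \<open>arg W\<close>, whose numerator has degree \<open>2 m'\<close> because \<open>p' / p\<close> has only \<open>m'\<close> simple
  poles; so there are at most \<open>2 m' + 2\<close>. Since \<open>m' \<le> m \<le> n\<close>, all three numbers coincide: the best
  approximation has exactly \<open>n\<close> distinct poles.

  Uniqueness (\<open>optimal_unique\<close>) follows from convexity: the sum of two optimal denominators is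
  optimal, at each of its \<open>2 n + 2\<close> extremal points both summands are extremal with the same phase,
  and so \<open>p\<^sub>1 dagger p\<^sub>2 - p\<^sub>2 dagger p\<^sub>1\<close>, of degree at most \<open>2 n\<close>, vanishes identically.

  The optimal \<open>s\<close> depends on \<open>\<omega>\<close> in a Lipschitz way, so that any sequence of optimal
  denominators for \<open>\<omega>\<^sub>k \<longlonglongrightarrow> \<omega>\<^sub>a\<close> has a subsequence converging, after scaling, to the optimal
  denominator for \<open>\<omega>\<^sub>a\<close>. All of them have degree exactly \<open>n\<close> and simple zeros, so the zeros
  converge (\<open>optimal_roots_approach\<close>, \<open>convergent_numbering\<close>).
\<close>

section \<open>The dagger involution and irreducible representatives\<close>

abbreviation on_axis :: "complex poly \<Rightarrow> real \<Rightarrow> complex" where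
  "on_axis p x \<equiv> poly p (\<i> * of_real x)"

lemma on_axis_dagger: "on_axis (dagger p) x = cnj (on_axis p x)"
  by (simp add: poly_dagger)

lemma poly_ext: "(\<And>z. poly p z = poly q z) \<Longrightarrow> p = q" for p q :: "complex poly"
  by (simp add: poly_eq_poly_eq_iff[symmetric] fun_eq_iff)

lemma dagger_mult: "dagger (p * q) = dagger p * dagger q"
  by (rule poly_ext) (simp add: poly_dagger)

lemma dagger_add: "dagger (p + q) = dagger p + dagger q"
  by (rule poly_ext) (simp add: poly_dagger)

lemma dagger_diff: "dagger (p - q) = dagger p - dagger q"
  by (rule poly_ext) (simp add: poly_dagger)

lemma dagger_smult: "dagger (smult c p) = smult (cnj c) (dagger p)"
  by (rule poly_ext) (simp add: poly_dagger)

lemma dagger_dagger [simp]: "dagger (dagger p) = p"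
  by (rule poly_ext) (simp add: poly_dagger)

lemma degree_dagger [simp]: "degree (dagger p) = degree p"
  by (simp add: dagger_def degree_pcompose degree_map_poly)

lemma dagger_0 [simp]: "dagger 0 = 0"
  by (simp add: dagger_def)

lemma dagger_eq_0_iff [simp]: "dagger p = 0 \<longleftrightarrow> p = 0"
  by (metis dagger_0 dagger_dagger)

lemma dagger_dvd_iff: "dagger p dvd dagger q \<longleftrightarrow> p dvd q"
  by (metis dagger_dagger dagger_mult dvd_def)

text \<open>
  A denominator \<open>p\<close> for which \<open>dagger p / p\<close> is already in lowest terms.
\<close>

definition reduced :: "complex poly \<Rightarrow> bool" where
  "reduced p \<longleftrightarrow> p \<noteq> 0 \<and> coprime p (dagger p)"

lemma dvd_same_degree_imp_smult:
  fixes p q :: "complex poly"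
  assumes "p dvd q" "degree q \<le> degree p" "q \<noteq> 0"
  obtains c where "q = smult c p" "c \<noteq> 0"
proof -
  from assms(1) obtain r where r: "q = p * r" by (auto simp: dvd_def)
  with assms have "p \<noteq> 0" "r \<noteq> 0" by auto
  with r assms(2) have "degree r = 0" by (simp add: degree_mult_eq)
  then obtain c where "r = [:c:]" by (rule degree_eq_zeroE)
  with r \<open>r \<noteq> 0\<close> show ?thesis by (intro that[of c]) auto
qed

text \<open>
  The common factor \<open>gcd p (dagger p)\<close> is mapped by the involution to a unimodular multiple of itself;
  after multiplication with a suitable constant it is fixed by the involution, that is, real on the
  imaginary axis, and cancels from \<open>dagger p / p\<close>.
\<close>

lemma reduced_decomposition:
  assumes "p \<noteq> 0"
  obtains h q where "p = h * q" "dagger h = h" "h \<noteq> 0" "reduced q"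
proof -
  define g where "g = gcd p (dagger p)"
  have g0: "g \<noteq> 0" using assms by (simp add: g_def)
  obtain q0 q1 where q: "p = q0 * g" "dagger p = q1 * g" "coprime q0 q1"
    using gcd_coprime_exists[of p "dagger p"] g0 unfolding g_def by auto
  have "dagger g dvd g"
    unfolding g_def using dagger_dvd_iff[of g p] dagger_dvd_iff[of g "dagger p"]
    by (simp add: g_def)
  then obtain c where c: "g = smult c (dagger g)" "c \<noteq> 0"
    using g0 by (elim dvd_same_degree_imp_smult) auto
  have "g = smult (c * cnj c) g"
    using c(1) by (metis dagger_dagger dagger_smult smult_smult)
  then have "c * cnj c = 1"
    using g0 by (metis (no_types) lead_coeff_smult leading_coeff_0_iff mult_cancel_right1)
  then have "complex_of_real ((cmod c)\<^sup>2) = 1" by (simp only: complex_norm_square)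
  then have cabs: "cmod c = 1"
    using norm_ge_zero[of c] by (auto simp: power2_eq_1_iff simp del: of_real_power)
  \<comment> \<open>A square root of \<open>c\<close> has modulus one and distributes the factor symmetrically.\<close>
  define l where "l = cnj (csqrt c)"
  have ll: "l * cnj l = 1"
    using cabs by (simp add: l_def complex_norm_square[symmetric] mult.commute)
  have "cnj l * cnj l = c" by (simp add: l_def flip: power2_eq_square)
  then have lc: "cnj l = c * l" using ll by (metis mult.assoc mult.commute mult.right_neutral)
  define h where "h = smult l g"
  define q where "q = smult (cnj l) q0"
  have "dagger h = h"
    unfolding h_def dagger_smult
    by (subst (2) c(1)) (simp add: lc mult.commute)
  moreover have ph: "p = h * q" using q(1) ll by (simp add: h_def q_def mult.commute)
  moreover have "h \<noteq> 0" using ll g0 by (auto simp: h_def)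
  moreover have "reduced q"
  proof -
    have "h * dagger q = q1 * g" using q(2) ph \<open>dagger h = h\<close> by (metis dagger_mult)
    then have "g * smult l (dagger q) = g * q1"
      by (simp add: h_def mult.commute)
    then have "smult l (dagger q) = q1"
      using g0 by (simp only: mult_cancel_left) simp
    then have "dagger q = smult (cnj l) q1" using ll by (auto simp: mult.commute)
    moreover have "l \<noteq> 0" using ll by auto
    ultimately have "coprime q (dagger q)"
      unfolding q_def using coprime_common_divisor[OF q(3)]
      by (metis coprimeI dvd_smult_cancel complex_cnj_zero_iff)
    moreover have "q \<noteq> 0" using ph assms by auto
    ultimately show ?thesis by (simp add: reduced_def)
  qed
  ultimately show ?thesis using that by blast
qed

text \<open>
  A zero of \<open>p\<close> on the imaginary axis is also a zero of \<open>dagger p\<close>, so it would cancel.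
\<close>

lemma on_axis_reduced_nonzero:
  assumes "reduced p" shows "on_axis p x \<noteq> 0"
proof
  assume *: "on_axis p x = 0"
  then have "on_axis (dagger p) x = 0" by (simp only: on_axis_dagger complex_cnj_zero)
  with * assms show False
    unfolding reduced_def by (meson coprime_poly_0)
qed

lemma on_axis_selfdual_real:
  assumes "dagger h = h" shows "on_axis h x = of_real (Re (on_axis h x))"
  using on_axis_dagger[of h x] assms by (simp add: complex_eq_iff)

text \<open>
  The normal form of a fraction differs from any coprime representation by a common constant factor,
  which drops out of the quotient.
\<close>

lemma rat_eval_reduced:
  assumes "reduced p"
  shows "rat_eval (Fract (dagger p) p) z = poly (dagger p) z / poly p z"
proof -
  define r where "r = Fract (dagger p) p"
  define a where "a = fst (quot_of_fract r)"
  define b where "b = snd (quot_of_fract r)"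
  have p0: "p \<noteq> 0" and cop: "coprime p (dagger p)" using assms by (auto simp: reduced_def)
  have b0: "b \<noteq> 0" by (simp add: b_def)
  have "Fract a b = Fract (dagger p) p" by (simp add: a_def b_def r_def)
  then have eq: "a * p = dagger p * b" using p0 b0 by (simp add: eq_fract)
  have ab: "coprime a b" by (simp add: a_def b_def coprime_quot_of_fract)
  have "p dvd b" using eq cop by (metis coprime_dvd_mult_right_iff dvd_triv_right)
  moreover have "b dvd p" using eq ab
    by (metis coprime_commute coprime_dvd_mult_right_iff dvd_triv_right)
  then have "degree b \<le> degree p" using p0 by (rule dvd_imp_degree_le)
  ultimately obtain c where c: "b = smult c p" "c \<noteq> 0" using b0
    by (rule dvd_same_degree_imp_smult)
  have "a * p = smult c (dagger p) * p" using eq c(1) by (simp add: mult.commute)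
  then have "a = smult c (dagger p)" using p0 by (simp only: mult_cancel_right) simp
  then show ?thesis using c unfolding rat_eval_def r_def[symmetric] a_def[symmetric] b_def[symmetric]
    by simp
qed

lemma poles_reduced:
  assumes "reduced p"
  shows "poles (Fract (dagger p) p) = {z. poly p z = 0}"
proof -
  let ?f = "\<lambda>z. poly (dagger p) z / poly p z"
  have ev: "rat_eval (Fract (dagger p) p) = ?f" using rat_eval_reduced[OF assms] by auto
  have p0: "p \<noteq> 0" and cop: "coprime p (dagger p)" using assms by (auto simp: reduced_def)
  have "is_pole ?f z \<longleftrightarrow> poly p z = 0" for z
  proof
    assume "poly p z = 0"
    have nz: "poly (dagger p) z \<noteq> 0" using cop \<open>poly p z = 0\<close> by (meson coprime_poly_0)
    have "\<forall>\<^sub>F w in at z. poly p w \<noteq> 0"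
      using poly_roots_finite[OF p0] 
      by (auto simp: eventually_at_filter dest!: islimpt_finite[of _ z] simp: islimpt_iff_eventually eventually_at_filter)
    then have "filterlim (poly p) (at 0) (at z)"
      using \<open>poly p z = 0\<close> by (intro filterlim_atI) (auto intro!: tendsto_eq_intros)
    moreover have "(poly (dagger p) \<longlongrightarrow> poly (dagger p) z) (at z)" by (intro tendsto_intros)
    ultimately show "is_pole ?f z" unfolding is_pole_def
      using nz by (intro filterlim_divide_at_infinity)
  next
    assume pole: "is_pole ?f z"
    show "poly p z = 0"
    proof (rule ccontr)
      assume "poly p z \<noteq> 0"
      then have "(?f \<longlongrightarrow> ?f z) (at z)" by (intro tendsto_intros)
      with pole show False unfolding is_pole_def
        using not_tendsto_and_filterlim_at_infinity[of "at z" ?f] by auto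
    qed
  qed
  then show ?thesis by (simp add: poles_def ev)
qed

section \<open>The approximation error in terms of the denominator\<close>

text \<open>
  This is the function \<open>W\<close> of the introduction. Distributing the exponential evenly over \<open>p\<close> and
  \<open>dagger p\<close> makes the error a function of the argument of \<open>W\<close> alone.
\<close>

definition rotated :: "real \<Rightarrow> complex poly \<Rightarrow> real \<Rightarrow> complex" where
  "rotated \<omega> p x = on_axis p x * cis (\<omega> * x / 2)"

lemma norm_rotated: "cmod (rotated \<omega> p x) = cmod (on_axis p x)"
  by (simp add: rotated_def norm_mult)

lemma rotated_add: "rotated \<omega> (p + q) x = rotated \<omega> p x + rotated \<omega> q x"
  by (simp add: rotated_def algebra_simps)

lemma rotated_of_real_smult: "rotated \<omega> (smult (of_real c) p) x = of_real c * rotated \<omega> p x"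
  by (simp add: rotated_def algebra_simps)

lemma rotated_uminus: "rotated \<omega> (- p) x = - rotated \<omega> p x"
  by (simp add: rotated_def)

text \<open>
  The exponential factors cancel, so comparing the phases of two denominators is a polynomial
  problem.
\<close>

lemma rotated_mult_cnj:
  "rotated \<omega> p x * cnj (rotated \<omega> q x) = on_axis (p * dagger q) x"
proof -
  have "cis (\<omega> * x / 2) * cnj (cis (\<omega> * x / 2)) = 1"
    by (simp add: cis_cnj cis_mult)
  then show ?thesis
    by (simp add: rotated_def on_axis_dagger mult_ac)
qed

lemma continuous_on_rotated [continuous_intros]: "continuous_on S (rotated \<omega> p)"
  unfolding rotated_def cis_conv_exp by (intro continuous_intros) auto

text \<open>
  With \<open>u = exp(i \<omega> x / 2)\<close> and \<open>P = p(ix)\<close> the error is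
  \<open>cnj P / P - u\<^sup>2 = u (cnj (P u) - P u) / P\<close>.
\<close>

lemma error_rotated:
  assumes "on_axis p x \<noteq> 0"
  shows "cmod (on_axis (dagger p) x / on_axis p x - exp (\<i> * of_real (\<omega> * x)))
         = 2 * \<bar>Im (rotated \<omega> p x)\<bar> / cmod (on_axis p x)"
proof -
  let ?c = "cis (\<omega> * x / 2)" and ?P = "on_axis p x"
  have cc: "cnj ?c * ?c = 1" by (simp add: cis_cnj cis_mult)
  have e: "exp (\<i> * of_real (\<omega> * x)) = ?c * ?c"
    by (simp add: cis_mult) (simp add: cis_conv_exp)
  have "cnj ?P / ?P - ?c * ?c = ?c * (cnj (?P * ?c) - ?P * ?c) / ?P"
    using assms cc by (simp add: field_simps)
  also have "cnj (?P * ?c) - ?P * ?c = - 2 * \<i> * of_real (Im (rotated \<omega> p x))"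
    unfolding rotated_def by (simp add: complex_eq_iff)
  finally show ?thesis
    unfolding e by (simp add: on_axis_dagger norm_mult norm_divide)
qed

text \<open>
  The sine of the argument of \<open>W\<close> is bounded by \<open>s\<close> in modulus. Multiplying out the denominator
  keeps the condition meaningful for polynomials with zeros on the axis, and so makes it closed.
\<close>

definition sine_bounded :: "real \<Rightarrow> real \<Rightarrow> complex poly \<Rightarrow> bool" where
  "sine_bounded \<omega> s p \<longleftrightarrow> (\<forall>x\<in>{-1..1}. \<bar>Im (rotated \<omega> p x)\<bar> \<le> s * cmod (on_axis p x))"

text \<open>
  A negative bound would force \<open>p\<close> to vanish on a whole segment.
\<close>

lemma sine_bounded_nonneg:
  assumes "sine_bounded \<omega> s p" "p \<noteq> 0" shows "s \<ge> 0"
proof (rule ccontr)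
  assume "\<not> 0 \<le> s"
  have "on_axis p x = 0" if "x \<in> {-1..1}" for x
  proof (rule ccontr)
    assume "on_axis p x \<noteq> 0"
    then have "s * cmod (on_axis p x) < 0" using \<open>\<not> 0 \<le> s\<close> by (simp add: mult_less_0_iff)
    with assms(1) that show False unfolding sine_bounded_def by (smt (verit) abs_ge_zero)
  qed
  then have "(\<lambda>x::real. \<i> * of_real x) ` {-1..1} \<subseteq> {z. poly p z = 0}" by auto
  moreover have "inj_on (\<lambda>x::real. \<i> * of_real x) {-1..1}" by (auto simp: inj_on_def)
  ultimately have "finite {-1..1::real}"
    using poly_roots_finite[OF assms(2)] by (meson finite_imageD finite_subset)
  then show False by (simp add: infinite_Icc)
qed

lemma closure_Icc_minus_finite:
  fixes F :: "real set"
  assumes "finite F" shows "{-1..1} \<subseteq> closure ({-1..1} - F)"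
proof
  fix x :: real assume x: "x \<in> {-1..1}"
  have "x islimpt {-1..1}"
    using x by (simp add: connected_imp_perfect)
  then have "x islimpt ({-1..1} - F)"
    using assms by (metis islimpt_Un_finite Un_Diff_cancel2 islimpt_Un islimpt_finite)
  then show "x \<in> closure ({-1..1} - F)" by (simp add: closure_def)
qed

text \<open>
  A factor fixed by the involution is real on the axis and leaves the bound unaffected away from its
  finitely many zeros; continuity supplies the bound at these points.
\<close>

lemma sine_bounded_selfdual_factor:
  assumes "dagger h = h" "h \<noteq> 0"
  shows "sine_bounded \<omega> s (h * q) \<longleftrightarrow> sine_bounded \<omega> s q"
proof -
  let ?H = "\<lambda>x. Re (on_axis h x)"
  have hq: "rotated \<omega> (h * q) x = of_real (?H x) * rotated \<omega> q x" for x
    using on_axis_selfdual_real[OF assms(1), of x] by (simp add: rotated_def mult_ac)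
  have n: "cmod (on_axis (h * q) x) = \<bar>?H x\<bar> * cmod (on_axis q x)" for x
    using on_axis_selfdual_real[OF assms(1), of x] by (metis norm_mult norm_of_real poly_mult)
  have iff: "\<bar>Im (rotated \<omega> (h * q) x)\<bar> \<le> s * cmod (on_axis (h * q) x)
     \<longleftrightarrow> \<bar>?H x\<bar> * \<bar>Im (rotated \<omega> q x)\<bar> \<le> \<bar>?H x\<bar> * (s * cmod (on_axis q x))" for x
    unfolding hq n by (simp add: abs_mult mult_ac)
  show ?thesis
  proof
    assume "sine_bounded \<omega> s q"
    then show "sine_bounded \<omega> s (h * q)"
      unfolding sine_bounded_def iff by (auto intro: mult_left_mono)
  next
    assume *: "sine_bounded \<omega> s (h * q)"
    define F where "F = {x::real. on_axis h x = 0}"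
    have "(\<lambda>x::real. \<i> * of_real x) ` F \<subseteq> {z. poly h z = 0}" by (auto simp: F_def)
    moreover have "inj_on (\<lambda>x::real. \<i> * of_real x) F" by (auto simp: inj_on_def)
    ultimately have "finite F"
      using poly_roots_finite[OF assms(2)] by (meson finite_imageD finite_subset)
    let ?d = "\<lambda>y. \<bar>Im (rotated \<omega> q y)\<bar> - s * cmod (on_axis q y)"
    have off: "?d y \<le> 0" if "y \<in> {-1..1} - F" for y
    proof -
      have "?H y \<noteq> 0" using that on_axis_selfdual_real[OF assms(1), of y] by (auto simp: F_def)
      moreover have "\<bar>?H y\<bar> * \<bar>Im (rotated \<omega> q y)\<bar> \<le> \<bar>?H y\<bar> * (s * cmod (on_axis q y))"
        using * that unfolding sine_bounded_def iff by auto
      ultimately show ?thesis by simp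
    qed
    have cont: "continuous_on (closure ({-1..1} - F)) ?d" by (intro continuous_intros)
    have "?d x \<le> 0" if "x \<in> {-1..1}" for x
      using continuous_le_on_closure[of "{-1..1} - F" ?d x 0, OF cont _ off]
        closure_Icc_minus_finite[OF \<open>finite F\<close>] that by blast
    then show "sine_bounded \<omega> s q" by (simp add: sine_bounded_def)
  qed
qed

lemma approx_error_le_iff_reduced:
  assumes "reduced p"
  shows "approx_error \<omega> (Fract (dagger p) p) \<le> 2 * s \<longleftrightarrow> sine_bounded \<omega> s p"
proof -
  let ?e = "\<lambda>x. 2 * \<bar>Im (rotated \<omega> p x)\<bar> / cmod (on_axis p x)"
  have nz: "on_axis p x \<noteq> 0" for x using assms by (rule on_axis_reduced_nonzero)
  have ae: "approx_error \<omega> (Fract (dagger p) p) = (SUP x\<in>{-1..1}. ?e x)"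
    unfolding approx_error_def rat_eval_reduced[OF assms] using error_rotated[OF nz] by simp
  have "compact (?e ` {-1..1})"
    using nz by (intro compact_continuous_image continuous_intros) auto
  then have "bdd_above (?e ` {-1..1})" by (intro bounded_imp_bdd_above compact_imp_bounded)
  then have "approx_error \<omega> (Fract (dagger p) p) \<le> 2 * s \<longleftrightarrow> (\<forall>x\<in>{-1..1}. ?e x \<le> 2 * s)"
    unfolding ae by (subst cSUP_le_iff) auto
  also have "\<dots> \<longleftrightarrow> sine_bounded \<omega> s p"
    unfolding sine_bounded_def using nz by (intro ball_cong) (auto simp: field_simps)
  finally show ?thesis .
qed

lemma Fract_selfdual_factor:
  assumes "dagger h = h" "h \<noteq> 0" "q \<noteq> 0"
  shows "Fract (dagger (h * q)) (h * q) = Fract (dagger q) q"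
  using assms by (simp add: dagger_mult eq_fract)

text \<open>
  Both sides depend only on the reduced factor of \<open>p\<close>, for which the supremum can be compared
  pointwise.
\<close>

lemma approx_error_le_iff:
  assumes "p \<noteq> 0"
  shows "approx_error \<omega> (Fract (dagger p) p) \<le> 2 * s \<longleftrightarrow> sine_bounded \<omega> s p"
proof -
  obtain h q where "p = h * q" "dagger h = h" "h \<noteq> 0" "reduced q"
    using reduced_decomposition[OF assms] .
  then show ?thesis
    using Fract_selfdual_factor[of h q] approx_error_le_iff_reduced[of q] sine_bounded_selfdual_factor[of h]
    by (auto simp: reduced_def)
qed

section \<open>Compactness and existence of optimal denominators\<close>

lemma poly_tendsto_coeffwise:
  fixes p :: "nat \<Rightarrow> complex poly"
  assumes "\<And>i. (\<lambda>k. coeff (p k) i) \<longlonglongrightarrow> coeff q i"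
    and "\<And>k. degree (p k) \<le> n" and "degree q \<le> n"
  shows "(\<lambda>k. poly (p k) z) \<longlonglongrightarrow> poly q z"
proof -
  have eq: "poly f z = (\<Sum>i\<le>n. coeff f i * z ^ i)" if "degree f \<le> n" for f
    using that poly_altdef[of f z]
    by (auto intro!: sum.mono_neutral_left intro: le_degree)
  have "(\<lambda>k. \<Sum>i\<le>n. coeff (p k) i * z ^ i) \<longlonglongrightarrow> (\<Sum>i\<le>n. coeff q i * z ^ i)"
    by (intro tendsto_intros assms)
  then show ?thesis using eq assms by simp
qed

lemma sine_bounded_closed:
  assumes "\<And>i. (\<lambda>k. coeff (p k) i) \<longlonglongrightarrow> coeff q i"
    and "\<And>k. degree (p k) \<le> n" and "degree q \<le> n"
    and "\<omega> \<longlonglongrightarrow> \<omega>'" and "s \<longlonglongrightarrow> s'"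
    and "\<And>k. sine_bounded (\<omega> k) (s k) (p k)"
  shows "sine_bounded \<omega>' s' q"
  unfolding sine_bounded_def
proof
  fix x :: real assume x: "x \<in> {-1..1}"
  have p: "(\<lambda>k. on_axis (p k) x) \<longlonglongrightarrow> on_axis q x"
    by (rule poly_tendsto_coeffwise) (use assms in auto)
  have "(\<lambda>k. \<bar>Im (rotated (\<omega> k) (p k) x)\<bar>) \<longlonglongrightarrow> \<bar>Im (rotated \<omega>' q x)\<bar>"
    unfolding rotated_def cis_conv_exp by (intro tendsto_intros p assms(4)) auto
  moreover have "(\<lambda>k. s k * cmod (on_axis (p k) x)) \<longlonglongrightarrow> s' * cmod (on_axis q x)"
    by (intro tendsto_intros p assms(5))
  ultimately show "\<bar>Im (rotated \<omega>' q x)\<bar> \<le> s' * cmod (on_axis q x)"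
    by (rule LIMSEQ_le) (use assms(6) x in \<open>auto simp: sine_bounded_def\<close>)
qed

lemma bounded_family_convergent_subseq:
  fixes a :: "nat \<Rightarrow> nat \<Rightarrow> complex"
  assumes "\<And>k i. cmod (a k i) \<le> B"
  shows "\<exists>f. strict_mono f \<and> (\<forall>i<m. convergent (\<lambda>k. a (f k) i))"
proof (induction m)
  case 0
  show ?case by (rule exI[of _ id]) (simp add: strict_mono_def)
next
  case (Suc m)
  then obtain f where f: "strict_mono f" "\<forall>i<m. convergent (\<lambda>k. a (f k) i)" by blast
  have "bounded (range (\<lambda>k. a (f k) m))" using assms by (auto intro!: boundedI)
  then obtain l g where g: "strict_mono g" "((\<lambda>k. a (f k) m) \<circ> g) \<longlonglongrightarrow> l"
    using bounded_imp_convergent_subsequence by blast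
  have "convergent (\<lambda>k. a ((f \<circ> g) k) i)" if "i < Suc m" for i
  proof (cases "i = m")
    case True then show ?thesis using g(2) by (auto simp: convergent_def o_def)
  next
    case False
    then have "convergent (\<lambda>k. a (f k) i)" using f that by auto
    from convergent_subseq_convergent[OF this g(1)] show ?thesis by (simp add: o_def)
  qed
  then show ?case using strict_mono_o[OF f(1) g(1)] by blast
qed

text \<open>
  Scaling to \<open>\<ell>\<^sup>1\<close>-norm one of the coefficient vector keeps the limit away from zero.
\<close>

lemma projective_compactness:
  fixes p :: "nat \<Rightarrow> complex poly"
  assumes "\<And>k. degree (p k) \<le> n" "\<And>k. p k \<noteq> 0"
  obtains f c q where "strict_mono f" "\<And>k. c k > (0::real)" "q \<noteq> 0" "degree q \<le> n"
    "\<And>i. (\<lambda>k. coeff (smult (of_real (c k)) (p (f k))) i) \<longlonglongrightarrow> coeff q i"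
proof -
  define N where "N k = (\<Sum>i\<le>n. cmod (coeff (p k) i))" for k
  have N: "N k > 0" for k
  proof -
    have "cmod (coeff (p k) (degree (p k))) \<le> N k"
      unfolding N_def using assms(1) by (intro member_le_sum) auto
    moreover have "cmod (coeff (p k) (degree (p k))) > 0" using assms(2) by simp
    ultimately show ?thesis by linarith
  qed
  define a where "a k i = of_real (1 / N k) * coeff (p k) i" for k i
  have "cmod (a k i) \<le> 1" for k i
  proof (cases "i \<le> n")
    case True
    then have "cmod (coeff (p k) i) \<le> N k" unfolding N_def by (intro member_le_sum) auto
    then show ?thesis using N[of k] by (simp add: a_def norm_mult norm_divide divide_simps)
  next
    case False
    then have "coeff (p k) i = 0" using assms(1)[of k] by (intro coeff_eq_0) auto
    then show ?thesis by (simp add: a_def)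
  qed
  then obtain f where f: "strict_mono f" "\<forall>i<Suc n. convergent (\<lambda>k. a (f k) i)"
    using bounded_family_convergent_subseq[of a 1 "Suc n"] by blast
  define l where "l i = lim (\<lambda>k. a (f k) i)" for i
  have l: "(\<lambda>k. a (f k) i) \<longlonglongrightarrow> l i" if "i \<le> n" for i
    using f(2) that unfolding l_def by (simp add: convergent_LIMSEQ_iff)
  define q where "q = (\<Sum>i\<le>n. monom (l i) i)"
  have cq: "coeff q i = (if i \<le> n then l i else 0)" for i
    by (simp add: q_def coeff_sum coeff_monom)
  have "(\<lambda>k. \<Sum>i\<le>n. cmod (a (f k) i)) \<longlonglongrightarrow> (\<Sum>i\<le>n. cmod (l i))"
    by (intro tendsto_intros l) auto
  moreover have "(\<Sum>i\<le>n. cmod (a k i)) = 1" for k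
    using N[of k] by (simp add: a_def norm_mult norm_divide N_def[symmetric] flip: sum_divide_distrib)
  ultimately have "(\<Sum>i\<le>n. cmod (l i)) = 1" by (simp add: LIMSEQ_const_iff)
  then have "q \<noteq> 0" using cq by (metis (mono_tags, lifting) atMost_iff coeff_0 norm_zero sum.neutral zero_neq_one)
  moreover have "degree q \<le> n" using cq by (intro degree_le) auto
  moreover have "(\<lambda>k. coeff (smult (of_real (1 / N (f k))) (p (f k))) i) \<longlonglongrightarrow> coeff q i" for i
  proof (cases "i \<le> n")
    case True then show ?thesis using l[OF True] by (simp add: a_def cq)
  next
    case False
    then have "coeff (p k) i = 0" for k using assms(1)[of k] by (intro coeff_eq_0) auto
    then show ?thesis using False by (simp add: cq)
  qed
  moreover have "1 / N (f k) > 0" for k using N by simp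
  ultimately show ?thesis using that[of f "\<lambda>k. 1 / N (f k)" q] f(1) by blast
qed

text \<open>
  \<open>p\<close> is the denominator of a best approximation and \<open>2 s\<close> is its error.
\<close>

definition sine_optimal :: "nat \<Rightarrow> real \<Rightarrow> real \<Rightarrow> complex poly \<Rightarrow> bool" where
  "sine_optimal n \<omega> s p \<longleftrightarrow> p \<noteq> 0 \<and> degree p \<le> n \<and> sine_bounded \<omega> s p \<and>
     (\<forall>q s'. q \<noteq> 0 \<and> degree q \<le> n \<and> sine_bounded \<omega> s' q \<longrightarrow> s \<le> s')"

lemma sine_bounded_pos_smult:
  assumes "c > 0"
  shows "sine_bounded \<omega> s (smult (of_real c) p) \<longleftrightarrow> sine_bounded \<omega> s p"
proof -
  have "dagger [:complex_of_real c:] = [:of_real c:]" by (rule poly_ext) (simp add: poly_dagger)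
  with sine_bounded_selfdual_factor[of "[:of_real c:]" \<omega> s p] assms show ?thesis by simp
qed

lemma sine_bounded_compactness:
  fixes p :: "nat \<Rightarrow> complex poly"
  assumes "\<And>k. degree (p k) \<le> n" "\<And>k. p k \<noteq> 0" "\<And>k. sine_bounded (\<omega> k) (s k) (p k)"
    and "\<omega> \<longlonglongrightarrow> \<omega>'" "s \<longlonglongrightarrow> s'"
  obtains f c q where "strict_mono f" "\<And>k. c k > (0::real)" "q \<noteq> 0" "degree q \<le> n"
    "\<And>i. (\<lambda>k. coeff (smult (of_real (c k)) (p (f k))) i) \<longlonglongrightarrow> coeff q i"
    "sine_bounded \<omega>' s' q"
proof -
  obtain f c q where fcq: "strict_mono f" "\<And>k. c k > (0::real)" "q \<noteq> 0" "degree q \<le> n"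
    "\<And>i. (\<lambda>k. coeff (smult (of_real (c k)) (p (f k))) i) \<longlonglongrightarrow> coeff q i"
    by (rule projective_compactness[of p n, OF assms(1,2)]) (rule that; assumption)
  have "sine_bounded \<omega>' s' q"
  proof (rule sine_bounded_closed[OF fcq(5)])
    show "(\<omega> \<circ> f) \<longlonglongrightarrow> \<omega>'" "(s \<circ> f) \<longlonglongrightarrow> s'"
      using assms(4,5) fcq(1) LIMSEQ_subseq_LIMSEQ by blast+
    show "sine_bounded ((\<omega> \<circ> f) k) ((s \<circ> f) k) (smult (of_real (c k)) (p (f k)))" for k
      using assms(3) fcq(2) by (simp add: sine_bounded_pos_smult)
    show "degree (smult (of_real (c k)) (p (f k))) \<le> n" for k
      using assms(1) fcq(2)[of k] by simp
  qed fact
  with fcq show ?thesis using that by blast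
qed

text \<open>
  A minimising sequence has, after scaling, a nonzero limit, and the bound passes to the limit.
\<close>

lemma sine_optimal_exists: "\<exists>s p. sine_optimal n \<omega> s p"
proof -
  define S where "S = {s. \<exists>p. p \<noteq> 0 \<and> degree p \<le> n \<and> sine_bounded \<omega> s p}"
  have "sine_bounded \<omega> 1 1"
    unfolding sine_bounded_def norm_rotated[of \<omega>, symmetric] by (simp add: abs_Im_le_cmod)
  then have "S \<noteq> {}" by (auto simp: S_def intro!: exI[of _ 1])
  have bdd: "bdd_below S"
    by (rule bdd_belowI[of _ 0]) (auto simp: S_def intro: sine_bounded_nonneg)
  have "\<exists>s\<in>S. s < Inf S + 1 / real (Suc k)" for k
    using cInf_lessD[OF \<open>S \<noteq> {}\<close>, of "Inf S + 1 / real (Suc k)"] by auto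
  then obtain s where s: "\<And>k. s k \<in> S" "\<And>k. s k < Inf S + 1 / real (Suc k)" by metis
  then have "\<forall>k. \<exists>p. p \<noteq> 0 \<and> degree p \<le> n \<and> sine_bounded \<omega> (s k) p" by (auto simp: S_def)
  then obtain p where p: "\<And>k. p k \<noteq> 0" "\<And>k. degree (p k) \<le> n" "\<And>k. sine_bounded \<omega> (s k) (p k)"
    by metis
  have "s \<longlonglongrightarrow> Inf S"
  proof (rule tendsto_sandwich[of "\<lambda>_. Inf S" _ _ "\<lambda>k. Inf S + 1 / real (Suc k)"])
    show "\<forall>\<^sub>F k in sequentially. Inf S \<le> s k" using cInf_lower[OF s(1) bdd] by simp
    show "\<forall>\<^sub>F k in sequentially. s k \<le> Inf S + 1 / real (Suc k)" using s(2) by (simp add: less_imp_le)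
    show "(\<lambda>k. Inf S + 1 / real (Suc k)) \<longlonglongrightarrow> Inf S"
      using tendsto_add[OF tendsto_const LIMSEQ_Suc[OF lim_1_over_n], of "Inf S"] by simp
  qed simp
  then obtain q where "q \<noteq> 0" "degree q \<le> n" "sine_bounded \<omega> (Inf S) q"
    by (rule sine_bounded_compactness[of p n "\<lambda>_. \<omega>" s \<omega> "Inf S", OF p(2,1,3) tendsto_const])
       (assumption | rule that)+
  moreover have "Inf S \<le> s'" if "q' \<noteq> 0" "degree q' \<le> n" "sine_bounded \<omega> s' q'" for s' q'
    using that bdd by (intro cInf_lower) (auto simp: S_def)
  ultimately show ?thesis unfolding sine_optimal_def by blast
qed

section \<open>An error below two\<close>

lemma Re_of_real_mult: "Re (of_real r * z) = r * Re z"
  by simp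

text \<open>
  Where \<open>G \<le> 0\<close> the function \<open>F\<close> is bounded below by a positive constant, by compactness. The
  conclusion covers all small \<open>c\<close>, so that finitely many such perturbations can be
  combined.
\<close>

lemma positive_perturbation:
  fixes F G :: "'a::topological_space \<Rightarrow> real"
  assumes "compact K" "continuous_on K F" "continuous_on K G"
    and "\<And>x. x \<in> K \<Longrightarrow> F x \<ge> 0" "\<And>x. x \<in> K \<Longrightarrow> F x = 0 \<Longrightarrow> G x > 0"
  shows "\<exists>c0>0. \<forall>c\<in>{0<..c0}. \<forall>x\<in>K. F x + c * G x > 0"
proof -
  define L where "L = {x \<in> K. G x \<le> 0}"
  show ?thesis
  proof (cases "L = {}")
    case True
    then show ?thesis using assms(4) unfolding L_def
      by (intro exI[of _ 1]) (auto simp: not_le intro!: add_nonneg_pos mult_pos_pos)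
  next
    case False
    have "compact L"
    proof -
      have "\<exists>C. closed C \<and> C \<inter> K = G -` {..0} \<inter> K"
        using assms(3) closed_atMost unfolding continuous_on_closed_invariant by blast
      then obtain C where "closed C" "C \<inter> K = G -` {..0} \<inter> K" by blast
      then have "L = K \<inter> C" by (auto simp: L_def)
      then show ?thesis using assms(1) \<open>closed C\<close> by (auto intro: compact_Int_closed)
    qed
    have "L \<subseteq> K" by (auto simp: L_def)
    obtain a where a: "a \<in> L" "\<forall>x\<in>L. F a \<le> F x"
      using continuous_attains_inf[OF \<open>compact L\<close> False] continuous_on_subset[OF assms(2) \<open>L \<subseteq> K\<close>]
      by blast
    obtain b where b: "b \<in> L" "\<forall>x\<in>L. G b \<le> G x"
      using continuous_attains_inf[OF \<open>compact L\<close> False] continuous_on_subset[OF assms(3) \<open>L \<subseteq> K\<close>]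
      by blast
    have Fa: "F a > 0" using a assms(4,5) by (force simp: L_def)
    have Gb: "G b \<le> 0" using b by (simp add: L_def)
    define c0 where "c0 = F a / (1 - G b)"
    have "c0 > 0" using Fa Gb by (simp add: c0_def)
    moreover have "F x + c * G x > 0" if "c \<in> {0<..c0}" "x \<in> K" for c x
    proof (cases "x \<in> L")
      case True
      have "c * (1 - G b) \<le> F a" using that(1) Gb by (simp add: c0_def field_simps)
      then have "F a + c * G b > 0" using that(1) by (simp add: algebra_simps)
      moreover have "c * G b \<le> c * G x" using True b that(1) by (intro mult_left_mono) auto
      ultimately show ?thesis using a True by force
    next
      case False
      then show ?thesis using that assms(4)
        by (auto simp: L_def not_le intro!: add_nonneg_pos mult_pos_pos)
    qed
    ultimately show ?thesis by blast
  qed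
qed

text \<open>
  By compactness a pointwise strict bound leaves a uniform margin; this is how a candidate denominator is
  turned into a competitor with strictly smaller error.
\<close>

lemma sine_bounded_of_strict:
  assumes "\<And>x. x \<in> {-1..1} \<Longrightarrow> \<bar>Im (rotated \<omega> p x)\<bar> < s * cmod (on_axis p x)" "s > 0"
  shows "\<exists>s'<s. sine_bounded \<omega> s' p"
proof -
  let ?e = "\<lambda>x. \<bar>Im (rotated \<omega> p x)\<bar> / cmod (on_axis p x)"
  have nz: "on_axis p x \<noteq> 0" if "x \<in> {-1..1}" for x using assms(1)[OF that] by auto
  have "continuous_on {-1..1} ?e" using nz by (intro continuous_intros) auto
  then obtain a where a: "a \<in> {-1..1}" "\<forall>x\<in>{-1..1}. ?e x \<le> ?e a"
    using continuous_attains_sup[of "{-1..1::real}" ?e] by auto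
  have "?e a < s" using assms(1)[OF a(1)] nz[OF a(1)] by (simp add: field_simps)
  moreover have "sine_bounded \<omega> (?e a) p"
    unfolding sine_bounded_def using a nz by (simp add: field_simps)
  ultimately show ?thesis by blast
qed

lemma prod_diff_swap:
  "(\<Prod>j\<in>A. a - b j) = (-1) ^ card A * (\<Prod>j\<in>A. b j - a)" for a :: real
  unfolding prod_constant[symmetric] prod.distrib[symmetric] by (intro prod.cong) auto

text \<open>
  The sine and the product change sign simultaneously, at \<open>\<pi>, 2 \<pi>, ..., n \<pi>\<close>. In the proof \<open>m \<pi>\<close> is
  the last multiple of \<open>\<pi>\<close> not beyond \<open>t\<close>.
\<close>

lemma sin_times_prod_nodes_nonneg:
  fixes t :: real
  assumes "0 < t" "t < (real n + 1) * pi"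
  shows "(-1) ^ n * (sin t * (\<Prod>j=1..n. t - real j * pi)) \<ge> 0"
    and "sin t = 0 \<Longrightarrow> \<exists>k\<in>{1..n}. t = real k * pi"
proof -
  define m where "m = nat \<lfloor>t / pi\<rfloor>"
  have m: "real m = of_int \<lfloor>t / pi\<rfloor>" using assms(1) by (simp add: m_def)
  have m1: "real m * pi \<le> t" "t < (real m + 1) * pi"
  proof -
    have "real m \<le> t / pi" "t / pi < real m + 1" unfolding m by linarith+
    then show "real m * pi \<le> t" "t < (real m + 1) * pi" by (auto simp: field_simps)
  qed
  have "real m * pi < (real n + 1) * pi" using m1(1) assms(2) by linarith
  then have "real m < real n + 1" by simp
  then have mn: "m \<le> n" by linarith
  have st: "sin t = (-1) ^ m * sin (t - real m * pi)"
    by (simp add: sin_diff mult.commute[of "real m" pi] sin_npi2 cos_npi2 flip: power_mult_distrib)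
  have nonneg: "sin (t - real m * pi) \<ge> 0"
    using m1 by (intro sin_ge_zero) (auto simp: algebra_simps)
  have "(\<Prod>j=1..n. t - real j * pi) = (\<Prod>j=1..m. t - real j * pi) * (\<Prod>j=m+1..n. t - real j * pi)"
    using mn by (subst prod.union_disjoint[symmetric]) (auto intro!: prod.cong)
  also have "(\<Prod>j=m+1..n. t - real j * pi) = (-1) ^ (n - m) * (\<Prod>j=m+1..n. real j * pi - t)"
    by (subst prod_diff_swap) simp
  finally have pr: "(\<Prod>j=1..n. t - real j * pi)
      = (-1) ^ (n - m) * ((\<Prod>j=1..m. t - real j * pi) * (\<Prod>j=m+1..n. real j * pi - t))" by simp
  have p1: "(\<Prod>j=1..m. t - real j * pi) \<ge> 0"
  proof (rule prod_nonneg)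
    fix j assume "j \<in> {1..m}"
    then have "real j * pi \<le> real m * pi" by simp
    then show "0 \<le> t - real j * pi" using m1 by linarith
  qed
  have p2: "(\<Prod>j=m+1..n. real j * pi - t) \<ge> 0"
  proof (rule prod_nonneg)
    fix j assume "j \<in> {m+1..n}"
    then have "(real m + 1) * pi \<le> real j * pi" by (intro mult_right_mono) auto
    then show "0 \<le> real j * pi - t" using m1 by linarith
  qed
  have sg: "(-1) ^ n * ((-1) ^ m * (-1) ^ (n - m)) = (1::real)"
    using mn by (simp flip: power_add)
  have "(-1) ^ n * (sin t * (\<Prod>j=1..n. t - real j * pi))
     = ((-1) ^ n * ((-1) ^ m * (-1) ^ (n - m))) * (sin (t - real m * pi) *
        ((\<Prod>j=1..m. t - real j * pi) * (\<Prod>j=m+1..n. real j * pi - t)))"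
    unfolding st pr by (simp only: mult_ac)
  then show "(-1) ^ n * (sin t * (\<Prod>j=1..n. t - real j * pi)) \<ge> 0"
    unfolding sg using nonneg p1 p2 by simp
  assume "sin t = 0"
  then have "sin (t - real m * pi) = 0" using st by simp
  then have "t = real m * pi"
    using m1 sin_gt_zero[of "t - real m * pi"] by (force simp: algebra_simps)
  moreover have "m \<noteq> 0" using calculation assms(1) by (intro notI) simp
  ultimately show "\<exists>k\<in>{1..n}. t = real k * pi" using mn by (intro bexI[of _ m]) auto
qed

text \<open>
  The product is the derivative of \<open>v(t) = \<Prod>j. t - j \<pi>\<close> at the node \<open>k \<pi>\<close>; it alternates in sign like the
  cosine.
\<close>

lemma cos_times_deriv_prod_nodes_pos:
  assumes "k \<in> {1..n}"
  shows "(-1) ^ n * (cos (real k * pi) * (\<Prod>j\<in>{1..n}-{k}. real k * pi - real j * pi)) > 0"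
proof -
  have eq: "{1..n} - {k} = {1..<k} \<union> {k+1..n}" using assms by auto
  have "(\<Prod>j\<in>{1..n}-{k}. real k * pi - real j * pi)
     = (\<Prod>j\<in>{1..<k}. real k * pi - real j * pi) * (\<Prod>j\<in>{k+1..n}. real k * pi - real j * pi)"
    unfolding eq by (rule prod.union_disjoint) auto
  also have "(\<Prod>j\<in>{k+1..n}. real k * pi - real j * pi)
     = (-1) ^ (n - k) * (\<Prod>j\<in>{k+1..n}. real j * pi - real k * pi)"
    by (subst prod_diff_swap) simp
  finally have pr: "(\<Prod>j\<in>{1..n}-{k}. real k * pi - real j * pi) = (-1) ^ (n - k) *
     ((\<Prod>j\<in>{1..<k}. real k * pi - real j * pi) * (\<Prod>j\<in>{k+1..n}. real j * pi - real k * pi))"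
    by simp
  have "(\<Prod>j\<in>{1..<k}. real k * pi - real j * pi) > 0"
    by (intro prod_pos) (auto simp: left_diff_distrib[symmetric])
  moreover have "(\<Prod>j\<in>{k+1..n}. real j * pi - real k * pi) > 0"
    by (intro prod_pos) (auto simp: left_diff_distrib[symmetric])
  moreover have "(-1) ^ n * ((-1) ^ k * (-1) ^ (n - k)) = (1::real)"
    using assms by (simp flip: power_add)
  ultimately have pos: "0 < ((-1) ^ n * ((-1) ^ k * (-1) ^ (n - k)))
      * ((\<Prod>j\<in>{1..<k}. real k * pi - real j * pi) * (\<Prod>j\<in>{k+1..n}. real j * pi - real k * pi))"
    by simp
  have "cos (real k * pi) = (-1) ^ k" by simp
  then show ?thesis unfolding pr using pos by (simp only: mult_ac)
qed

text \<open>
  In the variable \<open>t = \<omega> x / 2 + (n + 1) \<pi> / 2\<close>, which runs through a compact part of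
  \<open>(0, (n + 1) \<pi>)\<close>, the function \<open>v sin\<close> has a constant sign and double zeros at the nodes; a
  small multiple of \<open>v' cos\<close> lifts it off zero. Both are real parts of a polynomial of degree at
  most \<open>n\<close> times \<open>exp(i t)\<close>.
\<close>

lemma positive_real_part_exists:
  assumes "0 < \<omega>" "\<omega> < (real n + 1) * pi"
  shows "\<exists>p. degree p \<le> n \<and> (\<forall>x\<in>{-1..1}. Re (rotated \<omega> p x) > 0)"
proof -
  \<comment> \<open>The shift \<open>\<theta>\<close> moves the symmetric range of \<open>\<omega> x / 2\<close> into \<open>(0, (n + 1) \<pi>)\<close>.\<close>
  define \<theta> where "\<theta> = (real n + 1) * pi / 2"
  define v where "v t = (\<Prod>j=1..n. t - real j * pi)" for t :: real
  define v' where "v' t = (\<Sum>k\<in>{1..n}. \<Prod>j\<in>{1..n}-{k}. t - real j * pi)" for t :: real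
  define K where "K = {\<theta> - \<omega> / 2..\<theta> + \<omega> / 2}"
  have K: "0 < t" "t < (real n + 1) * pi" if "t \<in> K" for t
    using that assms by (auto simp: K_def \<theta>_def)
  have v'_node: "v' (real k * pi) = (\<Prod>j\<in>{1..n}-{k}. real k * pi - real j * pi)"
    if "k \<in> {1..n}" for k
    unfolding v'_def using that by (subst sum.remove[of _ k]) (auto intro!: sum.neutral)
  have "\<exists>c0>0. \<forall>c\<in>{0<..c0}. \<forall>t\<in>K. (-1) ^ n * (sin t * v t) + c * ((-1) ^ n * (cos t * v' t)) > 0"
  proof (rule positive_perturbation)
    show "compact K" by (simp add: K_def)
    show "continuous_on K (\<lambda>t. (-1) ^ n * (sin t * v t))"
      "continuous_on K (\<lambda>t. (-1) ^ n * (cos t * v' t))"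
      unfolding v_def v'_def by (intro continuous_intros)+
    fix t assume t: "t \<in> K"
    show "(-1) ^ n * (sin t * v t) \<ge> 0"
      unfolding v_def using sin_times_prod_nodes_nonneg(1) K[OF t] by blast
    assume "(-1) ^ n * (sin t * v t) = 0"
    then have "sin t = 0 \<or> (\<exists>k\<in>{1..n}. t = real k * pi)" by (auto simp: v_def)
    then obtain k where "k \<in> {1..n}" "t = real k * pi"
      using sin_times_prod_nodes_nonneg(2)[of t n] K[OF t] by blast
    then show "(-1) ^ n * (cos t * v' t) > 0"
      using cos_times_deriv_prod_nodes_pos[of k n] v'_node by simp
  qed
  then obtain c where c: "\<forall>t\<in>K. (-1) ^ n * (sin t * v t) + c * ((-1) ^ n * (cos t * v' t)) > 0"
    by (metis greaterThanAtMost_iff order_refl)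
  \<comment> \<open>\<open>l\<close> is the affine map with \<open>l(ix) = t\<close>, and the constant in \<open>p\<close> supplies the phase \<open>\<theta>\<close> that
    \<open>rotated\<close> lacks; the factor \<open>- i\<close> turns the sine into a real part.\<close>
  define l where "l = [:complex_of_real \<theta>, - \<i> * of_real (\<omega> / 2):]"
  define V where "V = (\<Prod>j=1..n. [:- complex_of_real (real j * pi), 1:])"
  define V' where "V' = (\<Sum>k\<in>{1..n}. \<Prod>j\<in>{1..n}-{k}. [:- complex_of_real (real j * pi), 1:])"
  define q where "q = smult (- \<i>) V + smult (of_real c) V'"
  define p where "p = smult ((-1) ^ n * cis \<theta>) (pcompose q l)"
  have "degree V \<le> n"
    unfolding V_def by (rule order.trans[OF degree_prod_sum_le]) auto
  moreover have "degree V' \<le> n"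
    unfolding V'_def
    by (intro degree_sum_le) (auto intro!: order.trans[OF degree_prod_sum_le])
  ultimately have "degree q \<le> n"
    unfolding q_def by (intro degree_add_le) (auto intro: order.trans[OF degree_smult_le])
  moreover have "degree l \<le> 1" by (simp add: l_def)
  ultimately have "degree q * degree l \<le> n * 1" by (intro mult_mono) auto
  then have "degree p \<le> n" unfolding p_def by (simp add: degree_pcompose)
  moreover have "Re (rotated \<omega> p x) > 0" if "x \<in> {-1..1}" for x
  proof -
    define t where "t = \<theta> + \<omega> * x / 2"
    have "\<bar>\<omega> * x\<bar> \<le> \<omega> * 1" using that assms unfolding abs_mult by (intro mult_mono) auto
    then have "t \<in> K" by (auto simp: K_def t_def)
    have "poly l (\<i> * of_real x) = of_real t" by (simp add: l_def t_def complex_eq_iff)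
    moreover have "poly V (of_real t) = of_real (v t)" by (simp add: V_def v_def poly_prod)
    moreover have "poly V' (of_real t) = of_real (v' t)"
      by (simp add: V'_def v'_def poly_prod poly_sum)
    ultimately have "on_axis p x = (-1) ^ n * cis \<theta> * (- \<i> * of_real (v t) + of_real (c * v' t))"
      by (simp add: p_def q_def poly_pcompose)
    then have "rotated \<omega> p x = (-1) ^ n * (- \<i> * of_real (v t) + of_real (c * v' t)) * cis t"
      by (simp add: rotated_def t_def mult_ac flip: cis_mult)
    then have "Re (rotated \<omega> p x)
        = Re (of_real ((-1) ^ n) * ((- \<i> * of_real (v t) + of_real (c * v' t)) * cis t))"
      by (simp only: of_real_power of_real_minus of_real_1 mult.assoc)
    also have "\<dots> = (-1) ^ n * (sin t * v t) + c * ((-1) ^ n * (cos t * v' t))"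
    proof -
      have "Re ((- \<i> * of_real (v t) + of_real (c * v' t)) * cis t) = v t * sin t + c * v' t * cos t"
        by simp
      then show ?thesis unfolding Re_of_real_mult by (simp only: algebra_simps)
    qed
    finally show ?thesis using c \<open>t \<in> K\<close> by simp
  qed
  ultimately show ?thesis by blast
qed

lemma sine_bound_less_one_exists:
  assumes "0 < \<omega>" "\<omega> < (real n + 1) * pi"
  shows "\<exists>p s. p \<noteq> 0 \<and> degree p \<le> n \<and> sine_bounded \<omega> s p \<and> s < 1"
proof -
  obtain p where p: "degree p \<le> n" "\<forall>x\<in>{-1..1}. Re (rotated \<omega> p x) > 0"
    using positive_real_part_exists[OF assms] by blast
  have "\<exists>s<1. sine_bounded \<omega> s p"
  proof (rule sine_bounded_of_strict)
    fix x :: real assume "x \<in> {-1..1}"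
    then have "Re (rotated \<omega> p x) > 0" using p by blast
    then have "\<bar>Im (rotated \<omega> p x)\<bar> < cmod (rotated \<omega> p x)"
      unfolding cmod_def by (intro real_less_rsqrt) auto
    then show "\<bar>Im (rotated \<omega> p x)\<bar> < 1 * cmod (on_axis p x)" by (simp add: norm_rotated)
  qed simp
  moreover have "p \<noteq> 0" using p(2)[rule_format, of 0] by (auto simp: rotated_def)
  ultimately show ?thesis using p(1) by blast
qed

section \<open>Interpolation, Bezout identities and critical points\<close>

lemma polynomial_interpolation:
  fixes g :: "complex \<Rightarrow> complex"
  assumes "finite Z"
  shows "\<exists>H. degree H \<le> card Z - 1 \<and> (\<forall>z\<in>Z. poly H z = g z)"
  using assms
proof (induction Z)
  case empty
  show ?case by (intro exI[of _ 0]) simp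
next
  case (insert a Z)
  then obtain H where H: "degree H \<le> card Z - 1" "\<forall>z\<in>Z. poly H z = g z" by blast
  define M where "M = (\<Prod>z\<in>Z. [:- z, 1:])"
  have "poly M a \<noteq> 0" using insert by (auto simp: M_def poly_prod)
  moreover have "poly M z = 0" if "z \<in> Z" for z using that insert by (auto simp: M_def poly_prod)
  moreover have "degree M \<le> card Z"
    unfolding M_def by (rule order.trans[OF degree_prod_sum_le]) (use insert in auto)
  ultimately show ?case using H insert(1,2)
    by (intro exI[of _ "H + smult ((g a - poly H a) / poly M a) M"])
       (auto intro!: degree_add_le order.trans[OF degree_smult_le])
qed

text \<open>
  Interpolate and average with the dagger: on the imaginary axis this takes the real part.
\<close>

lemma selfdual_interpolation:
  fixes g :: "real \<Rightarrow> real"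
  assumes "finite E" "card E \<le> d + 1"
  obtains H where "dagger H = H" "degree H \<le> d" "\<And>x. x \<in> E \<Longrightarrow> on_axis H x = of_real (g x)"
proof -
  let ?z = "\<lambda>x::real. \<i> * of_real x"
  have "card (?z ` E) = card E" by (intro card_image) (auto simp: inj_on_def)
  moreover obtain H where H: "degree H \<le> card (?z ` E) - 1"
    "\<forall>z\<in>?z ` E. poly H z = of_real (g (Im z))"
    using polynomial_interpolation[of "?z ` E" "\<lambda>z. of_real (g (Im z))"] assms(1) by auto
  ultimately have d: "degree H \<le> d" using assms(2) by linarith
  let ?S = "smult (1 / 2) (H + dagger H)"
  have "dagger ?S = ?S" by (simp add: dagger_smult dagger_add add.commute)
  moreover have "degree ?S \<le> d" using d by (auto intro!: degree_add_le)
  moreover have "on_axis ?S x = of_real (g x)" if "x \<in> E" for x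
    using H(2) that by (simp add: on_axis_dagger)
  ultimately show ?thesis using that by blast
qed

text \<open>
  On the axis the identity reads \<open>Im (q cnj p) = H\<close>. Thus every real polynomial of degree at
  most \<open>n + degree p\<close> is the first order change of the phase of \<open>p\<close> (times \<open>\<bar>p\<bar>\<^sup>2\<close>) in some
  admissible direction. A solution \<open>X dagger p + Y p = 2 i H\<close> is reduced modulo \<open>p\<close> to control
  degrees and then antisymmetrised.
\<close>

lemma skew_bezout:
  assumes "reduced p" "degree p \<le> n" "dagger H = H" "degree H \<le> n + degree p"
  obtains q where "degree q \<le> n" "q * dagger p - dagger q * p = smult (2 * \<i>) H"
proof -
  let ?T = "smult (2 * \<i>) H"
  have p0: "p \<noteq> 0" using assms(1) by (simp add: reduced_def)
  obtain a b where ab: "a * dagger p + b * p = 1"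
    using assms(1) bezout_coefficients_fst_snd[of "dagger p" p]
    unfolding reduced_def by (metis coprime_commute coprime_iff_gcd_eq_1)
  define X where "X = (a * ?T) mod p"
  define Y where "Y = b * ?T + (a * ?T div p) * dagger p"
  have "X * dagger p + Y * p = (a * ?T mod p + a * ?T div p * p) * dagger p + b * ?T * p"
    unfolding X_def Y_def by (simp only: algebra_simps)
  also have "\<dots> = ?T * (a * dagger p + b * p)" unfolding mod_div_mult_eq by (simp only: algebra_simps)
  finally have XY: "X * dagger p + Y * p = ?T" using ab by simp
  have dX: "degree X \<le> degree p"
    using degree_mod_less[OF p0, of "a * ?T"] by (auto simp: X_def)
  have dY: "degree Y \<le> n"
  proof (cases "Y = 0")
    case False
    have "degree (X * dagger p) \<le> n + degree p"
      using degree_mult_le[of X "dagger p"] dX assms(2) by simp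
    then have "degree (?T - X * dagger p) \<le> n + degree p"
      using assms(4) by (intro degree_diff_le order.trans[OF degree_smult_le])
    moreover have "Y * p = ?T - X * dagger p" using XY by (simp add: algebra_simps)
    ultimately have "degree (Y * p) \<le> n + degree p" by simp
    then show ?thesis using False p0 by (simp add: degree_mult_eq)
  qed simp
  have "dagger (X * dagger p + Y * p) = dagger ?T" using XY by simp
  then have XY': "dagger X * p + dagger Y * dagger p = - ?T"
    by (simp add: dagger_add dagger_mult dagger_smult assms(3))
  \<comment> \<open>The identity and its image under the involution have opposite right-hand sides; half
    their difference is the required one.\<close>
  define q where "q = smult (1 / 2) (X - dagger Y)"
  have q2: "smult 2 q = X - dagger Y" "smult 2 (dagger q) = dagger X - Y"
    by (simp_all add: q_def dagger_smult dagger_diff)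
  have "smult 2 (q * dagger p - dagger q * p) = smult 2 q * dagger p - smult 2 (dagger q) * p"
    by (simp add: smult_diff_right)
  also have "\<dots> = (X * dagger p + Y * p) - (dagger X * p + dagger Y * dagger p)"
    unfolding q2 by (simp only: algebra_simps)
  also have "\<dots> = smult 2 ?T" unfolding XY XY' by (simp flip: smult_add_left)
  finally have "q * dagger p - dagger q * p = ?T" by (metis smult_cancel zero_neq_numeral)
  moreover have "degree q \<le> n"
    unfolding q_def using dX dY assms(2) by (intro order.trans[OF degree_smult_le] degree_diff_le) auto
  ultimately show ?thesis using that by blast
qed

text \<open>
  The equation says that \<open>arg W\<close> has derivative zero. Writing \<open>p' / p = R / D\<close> in lowest terms, \<open>D\<close> has
  a simple zero at each zero of \<open>p\<close>, and clearing denominators leaves the polynomial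
  \<open>R dagger D + dagger R D + \<omega> D dagger D\<close>, whose degree is \<open>2 degree D\<close> because \<open>\<omega> \<noteq> 0\<close> and \<open>R\<close>
  has smaller degree than \<open>D\<close>.
\<close>

lemma critical_points_card:
  assumes "p \<noteq> 0" "\<omega> \<noteq> 0"
  defines "C \<equiv> {x. on_axis p x \<noteq> 0 \<and>
      Re (on_axis (pderiv p) x * cnj (on_axis p x)) + \<omega> / 2 * (cmod (on_axis p x))\<^sup>2 = 0}"
  shows "finite C" "card C \<le> 2 * card {z. poly p z = 0}"
proof -
  define g where "g = gcd p (pderiv p)"
  have g0: "g \<noteq> 0" using assms by (simp add: g_def)
  obtain D R where DR: "p = D * g" "pderiv p = R * g" "coprime D R"
    using gcd_coprime_exists[of p "pderiv p"] g0 unfolding g_def by auto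
  have D0: "D \<noteq> 0" using DR assms by auto
  have degD: "degree D = card {z. poly p z = 0}"
  proof (cases "pderiv p = 0")
    case True
    then have "degree p = 0" by (simp add: pderiv_eq_0_iff)
    then obtain c where "p = [:c:]" by (rule degree_eq_zeroE)
    moreover have "degree D = 0" using \<open>degree p = 0\<close> DR(1) D0 g0 by (simp add: degree_mult_eq)
    ultimately show ?thesis using assms by simp
  next
    case False
    obtain u v where "g = u * p + v * pderiv p"
      unfolding g_def by (metis bezout_coefficients_fst_snd)
    then have "rsquarefree D" "\<And>a. poly D a = 0 \<longleftrightarrow> poly p a = 0"
      using poly_squarefree_decomp[OF False DR(1,2)] by auto
    then have sf: "rsquarefree D" and roots: "{z. poly D z = 0} = {z. poly p z = 0}" by auto
    have "degree D = degree (smult (lead_coeff D) (\<Prod>z | poly D z = 0. [:- z, 1:]))"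
      using complex_poly_decompose_rsquarefree[OF sf] by simp
    also have "\<dots> = card {z. poly D z = 0}"
      using D0 by (simp add: degree_prod_eq_sum_degree)
    finally show ?thesis by (simp only: roots)
  qed
  have degR: "R = 0 \<or> degree R < degree D"
  proof (cases "R = 0")
    case False
    then have "pderiv p \<noteq> 0" using DR g0 by simp
    then have "degree (pderiv p) < degree p"
      by (simp add: degree_pderiv pderiv_eq_0_iff)
    then show ?thesis using DR False D0 g0 by (simp add: degree_mult_eq)
  qed simp
  define m where "m = degree D"
  define N where "N = R * dagger D + dagger R * D + smult (of_real \<omega>) (D * dagger D)"
  \<comment> \<open>Only the last term of \<open>N\<close> reaches degree \<open>2 m\<close>.\<close>
  have "coeff N (m + m) = of_real \<omega> * (lead_coeff D * lead_coeff (dagger D))"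
  proof -
    have "coeff (R * dagger D) (m + m) = 0 \<and> coeff (dagger R * D) (m + m) = 0"
      using degR degree_mult_le[of R "dagger D"] degree_mult_le[of "dagger R" D]
      by (cases "R = 0") (auto simp: m_def intro!: coeff_eq_0)
    moreover have "coeff (D * dagger D) (m + m) = lead_coeff D * lead_coeff (dagger D)"
      using coeff_mult_degree_sum[of D "dagger D"] by (simp add: m_def)
    ultimately show ?thesis by (simp add: N_def)
  qed
  then have N0: "N \<noteq> 0" using D0 assms(2) by (metis coeff_0 dagger_eq_0_iff leading_coeff_0_iff mult_eq_0_iff of_real_eq_0_iff)
  have degN: "degree N \<le> 2 * m"
  proof -
    have "degree (R * dagger D) \<le> 2 * m" "degree (dagger R * D) \<le> 2 * m" "degree (D * dagger D) \<le> 2 * m"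
      using degR degree_mult_le[of R "dagger D"] degree_mult_le[of "dagger R" D] degree_mult_le[of D "dagger D"]
      by (auto simp: m_def)
    then show ?thesis unfolding N_def
      by (intro degree_add_le order.trans[OF degree_smult_le])
  qed
  have "(\<lambda>x. \<i> * of_real x) ` C \<subseteq> {z. poly N z = 0}"
  proof safe
    fix x assume "x \<in> C"
    define d r e where "d = on_axis D x" and "r = on_axis R x" and "e = on_axis g x"
    have pd: "on_axis p x = d * e" "on_axis (pderiv p) x = r * e"
      by (simp_all add: DR(1,2)[THEN arg_cong[where f = "\<lambda>p. on_axis p x"]] d_def r_def e_def)
    have "d * e \<noteq> 0" and eq: "Re (r * e * cnj (d * e)) + \<omega> / 2 * (cmod (d * e))\<^sup>2 = 0"
      using \<open>x \<in> C\<close> unfolding C_def mem_Collect_eq pd by blast+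
    have "r * e * cnj (d * e) = of_real ((cmod e)\<^sup>2) * (r * cnj d)"
      by (simp only: complex_norm_square complex_cnj_mult mult_ac)
    then have "Re (r * e * cnj (d * e)) = (cmod e)\<^sup>2 * Re (r * cnj d)"
      by (simp only: Re_of_real_mult)
    with eq have "(cmod e)\<^sup>2 * (2 * Re (r * cnj d) + \<omega> * (cmod d)\<^sup>2) = 0"
      by (simp add: norm_mult power_mult_distrib algebra_simps)
    then have "2 * Re (r * cnj d) + \<omega> * (cmod d)\<^sup>2 = 0" using \<open>d * e \<noteq> 0\<close> by simp
    moreover have "on_axis N x = of_real (2 * Re (r * cnj d) + \<omega> * (cmod d)\<^sup>2)"
    proof -
      have "r * cnj d + cnj r * d = of_real (2 * Re (r * cnj d))"
        using complex_add_cnj[of "r * cnj d"] by simp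
      moreover have "on_axis N x = (r * cnj d + cnj r * d) + of_real \<omega> * (d * cnj d)"
        by (simp add: N_def on_axis_dagger d_def r_def)
      ultimately show ?thesis unfolding complex_norm_square[symmetric] by simp
    qed
    ultimately show "on_axis N x = 0" by simp
  qed
  moreover have inj: "inj_on (\<lambda>x::real. \<i> * of_real x) C" by (auto simp: inj_on_def)
  ultimately show "finite C" using poly_roots_finite[OF N0] by (meson finite_imageD finite_subset)
  have "card C = card ((\<lambda>x::real. \<i> * of_real x) ` C)" by (simp add: card_image[OF inj])
  also have "\<dots> \<le> card {z. poly N z = 0}"
    using \<open>_ ` C \<subseteq> _\<close> poly_roots_finite[OF N0] by (intro card_mono)
  also have "\<dots> \<le> degree N" using N0 by (rule card_poly_roots_bound)
  finally show "card C \<le> 2 * card {z. poly p z = 0}" using degN degD by (simp add: m_def)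
qed

section \<open>Extremal points of optimal denominators\<close>

text \<open>
  A bound \<open>s\<close> on the sine is a bound \<open>s / sqrt (1 - s\<^sup>2)\<close> on the tangent. In this form the
  condition is linear in \<open>w\<close> on the half plane \<open>Re w > 0\<close>.
\<close>

lemma sine_cone_le:
  assumes "0 \<le> s" "s < 1"
  shows "\<bar>Im w\<bar> \<le> s * cmod w \<longleftrightarrow> sqrt (1 - s\<^sup>2) * \<bar>Im w\<bar> \<le> s * \<bar>Re w\<bar>"
proof -
  have s2: "s\<^sup>2 \<le> 1" using assms by (simp add: power_le_one)
  have sq: "\<bar>a\<bar> \<le> b \<longleftrightarrow> a\<^sup>2 \<le> b\<^sup>2" if "b \<ge> 0" for a b :: real
    using that abs_le_square_iff[of a b] by auto
  have "\<bar>Im w\<bar> \<le> s * cmod w \<longleftrightarrow> (Im w)\<^sup>2 \<le> s\<^sup>2 * ((Re w)\<^sup>2 + (Im w)\<^sup>2)"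
    using assms sq[of "s * cmod w" "Im w"] by (simp add: power_mult_distrib cmod_power2)
  also have "\<dots> \<longleftrightarrow> (1 - s\<^sup>2) * (Im w)\<^sup>2 \<le> s\<^sup>2 * (Re w)\<^sup>2" by (simp add: algebra_simps)
  also have "\<dots> \<longleftrightarrow> (sqrt (1 - s\<^sup>2) * Im w)\<^sup>2 \<le> (s * \<bar>Re w\<bar>)\<^sup>2"
    using s2 by (simp add: power_mult_distrib)
  also have "\<dots> \<longleftrightarrow> sqrt (1 - s\<^sup>2) * \<bar>Im w\<bar> \<le> s * \<bar>Re w\<bar>"
    using assms s2 sq[of "s * \<bar>Re w\<bar>" "sqrt (1 - s\<^sup>2) * Im w"] by (simp add: abs_mult)
  finally show ?thesis .
qed

lemma sine_cone_less:
  assumes "0 \<le> s" "s < 1"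
  shows "\<bar>Im w\<bar> < s * cmod w \<longleftrightarrow> sqrt (1 - s\<^sup>2) * \<bar>Im w\<bar> < s * \<bar>Re w\<bar>"
proof -
  have s2: "s\<^sup>2 \<le> 1" using assms by (simp add: power_le_one)
  have sq: "\<bar>a\<bar> < b \<longleftrightarrow> a\<^sup>2 < b\<^sup>2" if "b \<ge> 0" for a b :: real
    using that abs_le_square_iff[of b a] by auto
  have "\<bar>Im w\<bar> < s * cmod w \<longleftrightarrow> (Im w)\<^sup>2 < s\<^sup>2 * ((Re w)\<^sup>2 + (Im w)\<^sup>2)"
    using assms sq[of "s * cmod w" "Im w"] by (simp add: power_mult_distrib cmod_power2)
  also have "\<dots> \<longleftrightarrow> (1 - s\<^sup>2) * (Im w)\<^sup>2 < s\<^sup>2 * (Re w)\<^sup>2" by (simp add: algebra_simps)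
  also have "\<dots> \<longleftrightarrow> (sqrt (1 - s\<^sup>2) * Im w)\<^sup>2 < (s * \<bar>Re w\<bar>)\<^sup>2"
    using s2 by (simp add: power_mult_distrib)
  also have "\<dots> \<longleftrightarrow> sqrt (1 - s\<^sup>2) * \<bar>Im w\<bar> < s * \<bar>Re w\<bar>"
    using assms s2 sq[of "s * \<bar>Re w\<bar>" "sqrt (1 - s\<^sup>2) * Im w"] by (simp add: abs_mult)
  finally show ?thesis .
qed

definition extremal_points :: "real \<Rightarrow> real \<Rightarrow> complex poly \<Rightarrow> real set" where
  "extremal_points \<omega> s p = {x \<in> {-1..1}. \<bar>Im (rotated \<omega> p x)\<bar> = s * cmod (rotated \<omega> p x)}"

lemma sine_bounded_iff_cone:
  assumes "0 \<le> s" "s < 1" "\<And>x. x \<in> {-1..1} \<Longrightarrow> Re (rotated \<omega> p x) > 0"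
  shows "sine_bounded \<omega> s p \<longleftrightarrow>
    (\<forall>x\<in>{-1..1}. sqrt (1 - s\<^sup>2) * \<bar>Im (rotated \<omega> p x)\<bar> \<le> s * Re (rotated \<omega> p x))"
  unfolding sine_bounded_def norm_rotated[of \<omega>, symmetric] sine_cone_le[OF assms(1,2)]
  by (intro ball_cong refl) (simp add: abs_of_pos assms(3))

lemma extremal_points_iff_cone:
  assumes "0 \<le> s" "s < 1" "x \<in> {-1..1}" "Re (rotated \<omega> p x) > 0"
  shows "x \<in> extremal_points \<omega> s p \<longleftrightarrow>
    sqrt (1 - s\<^sup>2) * \<bar>Im (rotated \<omega> p x)\<bar> = s * Re (rotated \<omega> p x)"
  using sine_cone_le[OF assms(1,2), of "rotated \<omega> p x"] sine_cone_less[OF assms(1,2), of "rotated \<omega> p x"]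
    assms(3,4) unfolding extremal_points_def by auto

text \<open>
  A zero of \<open>Re W\<close> would make the sine equal to one; then use connectedness.
\<close>

lemma rotated_real_part_sign:
  assumes "reduced p" "sine_bounded \<omega> s p" "s < 1"
  shows "(\<forall>x\<in>{-1..1}. Re (rotated \<omega> p x) > 0) \<or> (\<forall>x\<in>{-1..1}. Re (rotated \<omega> p x) < 0)"
proof -
  let ?A = "\<lambda>x. Re (rotated \<omega> p x)"
  have nz: "?A x \<noteq> 0" if "x \<in> {-1..1}" for x
  proof
    assume "?A x = 0"
    then have "cmod (rotated \<omega> p x) = \<bar>Im (rotated \<omega> p x)\<bar>" by (simp add: cmod_def)
    moreover have "cmod (rotated \<omega> p x) > 0"
      using on_axis_reduced_nonzero[OF assms(1), of x] by (simp only: norm_rotated zero_less_norm_iff) simp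
    moreover have "\<bar>Im (rotated \<omega> p x)\<bar> \<le> s * cmod (rotated \<omega> p x)"
      using assms(2) that by (simp add: sine_bounded_def norm_rotated)
    ultimately show False using assms(3) by (simp add: mult_le_cancel_right1)
  qed
  have "connected (?A ` {-1..1})"
    by (intro connected_continuous_image continuous_intros) simp
  then have "is_interval (?A ` {-1..1})" by (simp add: is_interval_connected_1)
  then have "0 \<in> ?A ` {-1..1}" if "x \<in> {-1..1}" "y \<in> {-1..1}" "?A x \<le> 0" "?A y \<ge> 0" for x y
    using that unfolding is_interval_1 by blast
  then show ?thesis using nz by (smt (verit) imageE)
qed

lemma Im_of_real_mult: "Im (of_real r * z) = r * Im z"
  by simp

text \<open>
  At an interior extremal point the nonnegative function \<open>s Re W - \<sigma> sqrt (1 - s\<^sup>2) Im W\<close>, with \<open>\<sigma>\<close> the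
  sign of \<open>Im W\<close>, has a minimum of value zero. Hence both \<open>\<kappa> W\<close> and \<open>\<kappa> W'\<close> are purely imaginary, for
  \<open>\<kappa> = s + i \<sigma> sqrt (1 - s\<^sup>2)\<close>, and \<open>W' cnj W\<close> is real.
\<close>

lemma interior_extremal_critical:
  assumes "0 \<le> s" "s < 1" "\<And>y. y \<in> {-1..1} \<Longrightarrow> Re (rotated \<omega> p y) > 0" "sine_bounded \<omega> s p"
    and "x \<in> extremal_points \<omega> s p" "-1 < x" "x < 1"
  shows "Re (on_axis (pderiv p) x * cnj (on_axis p x)) + \<omega> / 2 * (cmod (on_axis p x))\<^sup>2 = 0"
proof -
  let ?W = "rotated \<omega> p" and ?c = "sqrt (1 - s\<^sup>2)"
  let ?u = "cis (\<omega> * x / 2)"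
  define W' where "W' = \<i> * (on_axis (pderiv p) x + of_real (\<omega> / 2) * on_axis p x) * ?u"
  have deriv: "(?W has_vector_derivative W') (at x)"
  proof -
    have "((\<lambda>z. poly p (\<i> * z) * exp (\<i> * (of_real \<omega> * z / 2))) has_field_derivative W') (at (of_real x))"
      unfolding W'_def cis_conv_exp
      by (auto intro!: derivative_eq_intros poly_DERIV[THEN DERIV_chain2] simp: algebra_simps)
    then have "((\<lambda>y. poly p (\<i> * of_real y) * exp (\<i> * (of_real \<omega> * of_real y / 2))) has_vector_derivative W') (at x)"
      by (rule has_vector_derivative_real_field)
    then show ?thesis by (simp add: rotated_def[abs_def] cis_conv_exp)
  qed
  have x: "x \<in> {-1..1}" using assms by auto
  have eq: "?c * \<bar>Im (?W x)\<bar> = s * Re (?W x)"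
    using extremal_points_iff_cone[of s x \<omega> p] assms x by simp
  define \<sigma> where "\<sigma> = (if Im (?W x) \<ge> 0 then 1 else (-1::real))"
  \<comment> \<open>\<open>Re (\<kappa> w) \<ge> 0\<close> is the linear constraint that is active at \<open>x\<close>.\<close>
  define \<kappa> where "\<kappa> = Complex s (\<sigma> * ?c)"
  have \<kappa>0: "\<kappa> \<noteq> 0" using assms(1,2) by (auto simp: \<kappa>_def complex_eq_iff \<sigma>_def power_strict_mono abs_square_eq_1)
  have Rek: "Re (\<kappa> * ?W y) = s * Re (?W y) - \<sigma> * ?c * Im (?W y)" for y by (simp add: \<kappa>_def)
  have zero: "Re (\<kappa> * ?W x) = 0" using eq unfolding Rek by (auto simp: \<sigma>_def split: if_splits)
  have nonneg: "Re (\<kappa> * ?W y) \<ge> 0" if "y \<in> {-1..1}" for y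
  proof -
    have "?c * \<bar>Im (?W y)\<bar> \<le> s * Re (?W y)"
      using sine_bounded_iff_cone[of s \<omega> p] assms that by blast
    moreover have "\<sigma> * ?c * Im (?W y) \<le> ?c * \<bar>Im (?W y)\<bar>"
    proof -
      have "0 \<le> ?c" using assms by (simp add: power_le_one)
      then have "?c * (\<sigma> * Im (?W y)) \<le> ?c * \<bar>Im (?W y)\<bar>"
        by (intro mult_left_mono) (auto simp: \<sigma>_def)
      then show ?thesis by (simp add: mult_ac)
    qed
    ultimately show ?thesis unfolding Rek by linarith
  qed
  have "((\<lambda>y. Re (\<kappa> * ?W y)) has_vector_derivative Re (\<kappa> * W')) (at x)"
    by (intro bounded_linear.has_vector_derivative[OF bounded_linear_Re] 
        bounded_linear.has_vector_derivative[OF bounded_linear_mult_right] deriv)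
  then have D: "((\<lambda>y. Re (\<kappa> * ?W y)) has_real_derivative Re (\<kappa> * W')) (at x)"
    by (simp add: has_real_derivative_iff_has_vector_derivative)
  have M: "\<forall>y. \<bar>x - y\<bar> < min (1 - x) (1 + x) \<longrightarrow> Re (\<kappa> * ?W x) \<le> Re (\<kappa> * ?W y)"
  proof (intro allI impI)
    fix y assume "\<bar>x - y\<bar> < min (1 - x) (1 + x)"
    then have "y \<in> {-1..1}" by (auto simp: abs_if split: if_splits)
    then show "Re (\<kappa> * ?W x) \<le> Re (\<kappa> * ?W y)" unfolding zero by (rule nonneg)
  qed
  have zero': "Re (\<kappa> * W') = 0"
    by (rule DERIV_local_min[OF D _ M]) (use assms(6,7) in simp)
  have "\<kappa> * W' * cnj (\<kappa> * ?W x) = of_real ((cmod \<kappa>)\<^sup>2) * (W' * cnj (?W x))"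
    by (simp only: complex_norm_square complex_cnj_mult mult_ac)
  then have "Im (\<kappa> * W' * cnj (\<kappa> * ?W x)) = (cmod \<kappa>)\<^sup>2 * Im (W' * cnj (?W x))"
    by (simp only: Im_of_real_mult)
  moreover have "Im (\<kappa> * W' * cnj (\<kappa> * ?W x)) = 0"
    using zero zero' by (simp only: times_complex.sel complex_cnj) simp
  ultimately have "Im (W' * cnj (?W x)) = 0" using \<kappa>0 by simp
  moreover have "W' * cnj (?W x) = \<i> * ((on_axis (pderiv p) x * cnj (on_axis p x))
       + of_real (\<omega> / 2 * (cmod (on_axis p x))\<^sup>2))"
  proof -
    have "?u * cnj ?u = 1" by (simp add: cis_cnj cis_mult)
    then have "W' * cnj (?W x) = \<i> * (on_axis (pderiv p) x + of_real (\<omega> / 2) * on_axis p x) * cnj (on_axis p x)"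
      unfolding W'_def rotated_def by (simp add: mult_ac)
    then show ?thesis unfolding of_real_mult[of "\<omega> / 2"] complex_norm_square by (simp only: algebra_simps)
  qed
  ultimately show ?thesis by simp
qed

text \<open>
  The hypothesis says that moving from \<open>p\<close> in the direction \<open>q\<close> turns \<open>W\<close> towards the real axis at
  all extremal points. Both linear constraints of the cone thereby become strict for a
  small step.
\<close>

lemma improving_perturbation:
  assumes "0 < s" "s < 1" "\<And>y. y \<in> {-1..1} \<Longrightarrow> Re (rotated \<omega> p y) > 0" "sine_bounded \<omega> s p"
    and "degree p \<le> n" "degree q \<le> n"
    and "\<And>x. x \<in> extremal_points \<omega> s p \<Longrightarrow>
        Im (rotated \<omega> q x * cnj (rotated \<omega> p x)) = - Im (rotated \<omega> p x)"
  shows "\<exists>p' s'. p' \<noteq> 0 \<and> degree p' \<le> n \<and> sine_bounded \<omega> s' p' \<and> s' < s"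
proof -
  let ?c = "sqrt (1 - s\<^sup>2)"
  define F where "F \<sigma> p x = s * Re (rotated \<omega> p x) - \<sigma> * ?c * Im (rotated \<omega> p x)" for \<sigma> p x
  have c0: "?c \<ge> 0" using assms(1,2) by (simp add: power_le_one)
  have cone: "?c * \<bar>Im (rotated \<omega> p x)\<bar> \<le> s * Re (rotated \<omega> p x)" if "x \<in> {-1..1}" for x
    using sine_bounded_iff_cone[of s \<omega> p] assms that by auto
  have "\<exists>c0>0. \<forall>c\<in>{0<..c0}. \<forall>x\<in>{-1..1}. F \<sigma> p x + c * F \<sigma> q x > 0" if \<sigma>: "\<sigma> \<in> {-1, 1}" for \<sigma>
  proof (rule positive_perturbation)
    show "continuous_on {-1..1} (F \<sigma> p)" "continuous_on {-1..1} (F \<sigma> q)"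
      unfolding F_def by (intro continuous_intros)+
    fix x :: real assume x: "x \<in> {-1..1}"
    have "\<sigma> * ?c * Im (rotated \<omega> p x) \<le> ?c * \<bar>Im (rotated \<omega> p x)\<bar>"
    proof -
      have "?c * (\<sigma> * Im (rotated \<omega> p x)) \<le> ?c * \<bar>Im (rotated \<omega> p x)\<bar>"
        using c0 \<sigma> by (intro mult_left_mono) auto
      then show ?thesis by (simp add: mult_ac)
    qed
    with cone[OF x] show "F \<sigma> p x \<ge> 0" by (simp add: F_def)
    assume F0: "F \<sigma> p x = 0"
    define A B A' B' where "A = Re (rotated \<omega> p x)" and "B = Im (rotated \<omega> p x)"
      and "A' = Re (rotated \<omega> q x)" and "B' = Im (rotated \<omega> q x)"
    have A: "A > 0" using assms(3)[OF x] by (simp add: A_def)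
    have sA: "s * A = \<sigma> * ?c * B" using F0 by (simp add: F_def A_def B_def)
    \<comment> \<open>Equality on the side \<open>\<sigma>\<close> makes \<open>x\<close> an extremal point, where the direction \<open>q\<close> is controlled.\<close>
    have "?c * \<bar>B\<bar> = s * A"
      using sA cone[OF x] \<open>_ \<le> ?c * \<bar>_\<bar>\<close> unfolding A_def B_def by linarith
    then have "x \<in> extremal_points \<omega> s p"
      using extremal_points_iff_cone[of s x \<omega> p] assms(1,2) x A unfolding A_def B_def by simp
    then have "B' * A - A' * B = - B"
      using assms(7) unfolding A_def B_def A'_def B'_def by simp
    moreover have "A * (s * A' - \<sigma> * ?c * B') = A' * (s * A - \<sigma> * ?c * B) - \<sigma> * ?c * (B' * A - A' * B)"
      by (simp only: algebra_simps)
    ultimately have "A * (s * A' - \<sigma> * ?c * B') = A' * (s * A - \<sigma> * ?c * B) - \<sigma> * ?c * (- B)"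
      by (simp only:)
    also have "\<dots> = s * A" using sA by simp
    finally have "A * (s * A' - \<sigma> * ?c * B') > 0" using A assms(1) by simp
    then have "s * A' - \<sigma> * ?c * B' > 0" using A by (simp add: zero_less_mult_iff)
    then show "F \<sigma> q x > 0" by (simp add: F_def A'_def B'_def)
  qed simp
  from this[of 1] this[of "-1"] obtain c1 c2 where
    c1: "c1 > 0" "\<And>c x. c \<in> {0<..c1} \<Longrightarrow> x \<in> {-1..1} \<Longrightarrow> F 1 p x + c * F 1 q x > 0" and
    c2: "c2 > 0" "\<And>c x. c \<in> {0<..c2} \<Longrightarrow> x \<in> {-1..1} \<Longrightarrow> F (-1) p x + c * F (-1) q x > 0"
    by auto
  \<comment> \<open>A common step size for the two sides of the cone.\<close>
  define c where "c = min c1 c2"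
  define p' where "p' = p + smult (of_real c) q"
  have Fp': "F \<sigma> p' x = F \<sigma> p x + c * F \<sigma> q x" for \<sigma> x
    by (simp add: F_def p'_def rotated_add rotated_of_real_smult algebra_simps)
  have pos: "F 1 p' x > 0" "F (-1) p' x > 0" if "x \<in> {-1..1}" for x
    using c1 c2 that unfolding Fp' by (auto simp: c_def)
  have strict: "?c * \<bar>Im (rotated \<omega> p' x)\<bar> < s * \<bar>Re (rotated \<omega> p' x)\<bar>" if "x \<in> {-1..1}" for x
  proof -
    have "?c * \<bar>Im (rotated \<omega> p' x)\<bar> < s * Re (rotated \<omega> p' x)"
      using pos[OF that] by (auto simp: F_def abs_if)
    also have "\<dots> \<le> s * \<bar>Re (rotated \<omega> p' x)\<bar>" using assms(1) by (intro mult_left_mono) auto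
    finally show ?thesis .
  qed
  have "\<exists>s'<s. sine_bounded \<omega> s' p'"
    using sine_cone_less[of s] strict assms(1,2)
    by (intro sine_bounded_of_strict) (auto simp flip: norm_rotated[of \<omega>])
  moreover have "p' \<noteq> 0" using pos[of 0] by (auto simp: F_def rotated_def)
  moreover have "degree p' \<le> n"
    unfolding p'_def using assms(5,6) by (intro degree_add_le order.trans[OF degree_smult_le])
  ultimately show ?thesis by blast
qed

lemma extremal_points_uminus: "extremal_points \<omega> s (- p) = extremal_points \<omega> s p"
  by (simp add: extremal_points_def rotated_uminus)

lemma sine_bounded_uminus: "sine_bounded \<omega> s (- p) \<longleftrightarrow> sine_bounded \<omega> s p"
  by (simp add: sine_bounded_def rotated_uminus)

lemma sine_optimal_uminus: "sine_optimal n \<omega> s (- p) \<longleftrightarrow> sine_optimal n \<omega> s p"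
  by (simp add: sine_optimal_def sine_bounded_uminus)

lemma dagger_uminus: "dagger (- p) = - dagger p"
  by (rule poly_ext) (simp add: poly_dagger)

lemma reduced_uminus: "reduced (- p) \<longleftrightarrow> reduced p"
  by (simp add: reduced_def dagger_uminus)

text \<open>
  The upper bound \<open>2 m' + 2\<close> counts critical points and the two end points, the lower bound
  \<open>n + m + 2\<close> holds since fewer extremal points could be improved by interpolation. They
  are compatible only if \<open>m' = m = n\<close>.
\<close>

lemma optimal_extremal_count_pos:
  assumes opt: "sine_optimal n \<omega> s p" and red: "reduced p" and \<omega>: "\<omega> \<noteq> 0" and s1: "s < 1"
    and pos: "\<And>y. y \<in> {-1..1} \<Longrightarrow> Re (rotated \<omega> p y) > 0"
  shows "degree p = n" "card {z. poly p z = 0} = n"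
    "finite (extremal_points \<omega> s p)" "2 * n + 2 \<le> card (extremal_points \<omega> s p)"
proof -
  let ?E = "extremal_points \<omega> s p"
  have p0: "p \<noteq> 0" and deg: "degree p \<le> n" and bd: "sine_bounded \<omega> s p"
    using opt by (auto simp: sine_optimal_def)
  have s0: "s \<ge> 0" using sine_bounded_nonneg[OF bd p0] .
  \<comment> \<open>Zeros of the derivative of \<open>arg W\<close>, which contain the interior extremal points.\<close>
  define C where "C = {x. on_axis p x \<noteq> 0 \<and>
      Re (on_axis (pderiv p) x * cnj (on_axis p x)) + \<omega> / 2 * (cmod (on_axis p x))\<^sup>2 = 0}"
  have C: "finite C" "card C \<le> 2 * card {z. poly p z = 0}"
    unfolding C_def using critical_points_card[OF p0 \<omega>] by auto
  have sub: "?E \<subseteq> C \<union> {-1, 1}"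
  proof
    fix x assume x: "x \<in> ?E"
    show "x \<in> C \<union> {-1, 1}"
    proof (cases "x = -1 \<or> x = 1")
      case False
      then have "-1 < x" "x < 1" using x by (auto simp: extremal_points_def)
      then have "x \<in> C"
        unfolding C_def using interior_extremal_critical[OF s0 s1 pos bd x] on_axis_reduced_nonzero[OF red]
        by blast
      then show ?thesis by blast
    qed auto
  qed
  show finE: "finite ?E" using sub C(1) by (rule finite_subset[OF _ finite_UnI]) simp
  have "card ?E \<le> card (C \<union> {-1, 1})" using sub C(1) by (intro card_mono) auto
  also have "\<dots> \<le> card C + card {-1, 1::real}" by (rule card_Un_le)
  finally have upper: "card ?E \<le> 2 * card {z. poly p z = 0} + 2" using C(2) by simp
  \<comment> \<open>For \<open>s = 0\<close> every point would be extremal, but there are only finitely many.\<close>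
  have "s \<noteq> 0"
  proof
    assume "s = 0"
    then have "{-1..1} \<subseteq> ?E" using bd by (auto simp: extremal_points_def sine_bounded_def)
    then have "finite {-1..1::real}" using finE by (rule finite_subset)
    then show False using infinite_Icc[of "-1::real" 1] by simp
  qed
  with s0 have sp: "s > 0" by simp
  have lower: "n + degree p + 2 \<le> card ?E"
  proof (rule ccontr)
    assume "\<not> n + degree p + 2 \<le> card ?E"
    then have "card ?E \<le> (n + degree p) + 1" by simp
    then obtain H where H: "dagger H = H" "degree H \<le> n + degree p"
      "\<And>x. x \<in> ?E \<Longrightarrow> on_axis H x = of_real (- Im (rotated \<omega> p x))"
      using selfdual_interpolation[OF finE, of "n + degree p" "\<lambda>x. - Im (rotated \<omega> p x)"] by metis
    obtain q where q: "degree q \<le> n" "q * dagger p - dagger q * p = smult (2 * \<i>) H"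
      using skew_bezout[OF red deg H(1,2)] .
    have "Im (rotated \<omega> q x * cnj (rotated \<omega> p x)) = - Im (rotated \<omega> p x)" if "x \<in> ?E" for x
    proof -
      have "on_axis (q * dagger p) x - cnj (on_axis (q * dagger p) x) = on_axis (q * dagger p - dagger q * p) x"
        by (simp add: on_axis_dagger)
      also have "\<dots> = 2 * \<i> * of_real (- Im (rotated \<omega> p x))"
        unfolding q(2) poly_smult H(3)[OF that] ..
      finally have "Im (on_axis (q * dagger p) x) = - Im (rotated \<omega> p x)"
        by (simp only: complex_diff_cnj) (simp add: complex_eq_iff)
      then show ?thesis by (simp only: rotated_mult_cnj)
    qed
    then obtain p' s' where "p' \<noteq> 0" "degree p' \<le> n" "sine_bounded \<omega> s' p'" "s' < s"
      using improving_perturbation[OF sp s1 pos bd deg q(1)] by blast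
    then show False using opt unfolding sine_optimal_def by force
  qed
  have roots: "card {z. poly p z = 0} \<le> degree p" using p0 by (rule card_poly_roots_bound)
  show "degree p = n" "card {z. poly p z = 0} = n" "2 * n + 2 \<le> card ?E"
    using upper lower roots deg by linarith+
qed

lemma optimal_extremal_count:
  assumes "sine_optimal n \<omega> s p" "reduced p" "\<omega> \<noteq> 0" "s < 1"
  shows "degree p = n" "card {z. poly p z = 0} = n"
    "finite (extremal_points \<omega> s p)" "2 * n + 2 \<le> card (extremal_points \<omega> s p)"
proof -
  have "sine_bounded \<omega> s p" using assms(1) by (simp add: sine_optimal_def)
  then consider "\<forall>x\<in>{-1..1}. Re (rotated \<omega> p x) > 0" | "\<forall>x\<in>{-1..1}. Re (rotated \<omega> p x) < 0"
    using rotated_real_part_sign[OF assms(2) _ assms(4)] by blast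
  then have "degree p = n \<and> card {z. poly p z = 0} = n \<and>
    finite (extremal_points \<omega> s p) \<and> 2 * n + 2 \<le> card (extremal_points \<omega> s p)"
  proof cases
    case 1
    then show ?thesis using optimal_extremal_count_pos[OF assms] by blast
  next
    case 2
    then have "Re (rotated \<omega> (- p) x) > 0" if "x \<in> {-1..1}" for x using that by (simp add: rotated_uminus)
    then show ?thesis
      using optimal_extremal_count_pos[of n \<omega> s "- p"] assms
      by (simp add: sine_optimal_uminus reduced_uminus extremal_points_uminus)
  qed
  then show "degree p = n" "card {z. poly p z = 0} = n"
    "finite (extremal_points \<omega> s p)" "2 * n + 2 \<le> card (extremal_points \<omega> s p)" by auto
qed

section \<open>Uniqueness\<close>

lemma sine_optimal_reduced_factor:
  assumes "sine_optimal n \<omega> s p" "p = h * q" "dagger h = h" "h \<noteq> 0"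
  shows "sine_optimal n \<omega> s q"
proof -
  have "q \<noteq> 0" using assms(1,2) by (auto simp: sine_optimal_def)
  moreover from this have "degree q \<le> degree p"
    using assms by (simp add: degree_mult_eq)
  ultimately show ?thesis
    using assms(1,2) sine_bounded_selfdual_factor[OF assms(3,4), of \<omega> s q]
    by (auto simp: sine_optimal_def)
qed

text \<open>
  The sum of the two denominators satisfies the same linear constraints and so is optimal. Where it attains
  equality in a constraint, both summands do, and on the same side of the cone, so their phases agree.
\<close>

lemma optimal_unique_pos:
  assumes opt: "sine_optimal n \<omega> s p1" "sine_optimal n \<omega> s p2" and \<omega>: "\<omega> \<noteq> 0" and s1: "s < 1"
    and pos: "\<And>y. y \<in> {-1..1} \<Longrightarrow> Re (rotated \<omega> p1 y) > 0" "\<And>y. y \<in> {-1..1} \<Longrightarrow> Re (rotated \<omega> p2 y) > 0"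
  shows "dagger p1 * p2 = dagger p2 * p1"
proof -
  let ?c = "sqrt (1 - s\<^sup>2)"
  have p12: "p1 \<noteq> 0" "p2 \<noteq> 0" and deg: "degree p1 \<le> n" "degree p2 \<le> n"
    and bd: "sine_bounded \<omega> s p1" "sine_bounded \<omega> s p2"
    using opt by (auto simp: sine_optimal_def)
  have s0: "s \<ge> 0" using sine_bounded_nonneg[OF bd(1) p12(1)] .
  have c0: "?c > 0" using s0 s1 by (simp add: power_less_one_iff abs_square_less_1)
  define p where "p = p1 + p2"
  have posp: "Re (rotated \<omega> p y) > 0" if "y \<in> {-1..1}" for y
    using pos that by (simp add: p_def rotated_add add_pos_pos)
  have cone: "?c * \<bar>Im (rotated \<omega> p1 x)\<bar> \<le> s * Re (rotated \<omega> p1 x)"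
    "?c * \<bar>Im (rotated \<omega> p2 x)\<bar> \<le> s * Re (rotated \<omega> p2 x)" if "x \<in> {-1..1}" for x
    using sine_bounded_iff_cone[OF s0 s1] pos bd that by blast+
  have "\<forall>x\<in>{-1..1}. ?c * \<bar>Im (rotated \<omega> p x)\<bar> \<le> s * Re (rotated \<omega> p x)"
  proof
    fix x :: real assume "x \<in> {-1..1}"
    note cone[OF this]
    moreover have "?c * \<bar>Im (rotated \<omega> p x)\<bar> \<le> ?c * (\<bar>Im (rotated \<omega> p1 x)\<bar> + \<bar>Im (rotated \<omega> p2 x)\<bar>)"
      using c0 by (intro mult_left_mono) (auto simp: p_def rotated_add)
    ultimately show "?c * \<bar>Im (rotated \<omega> p x)\<bar> \<le> s * Re (rotated \<omega> p x)"
      by (simp add: p_def rotated_add algebra_simps)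
  qed
  then have "sine_bounded \<omega> s p"
    using sine_bounded_iff_cone[of s \<omega> p] s0 s1 posp by blast
  moreover have "p \<noteq> 0" using posp[of 0] by (auto simp: rotated_def)
  moreover have "degree p \<le> n" unfolding p_def using deg by (intro degree_add_le)
  ultimately have optp: "sine_optimal n \<omega> s p" using opt(1) by (auto simp: sine_optimal_def)
  obtain h q where hq: "p = h * q" "dagger h = h" "h \<noteq> 0" "reduced q"
    using reduced_decomposition[OF \<open>p \<noteq> 0\<close>] .
  have "sine_optimal n \<omega> s q" using sine_optimal_reduced_factor[OF optp hq(1-3)] .
  note count = optimal_extremal_count[OF this hq(4) \<omega> s1]
  define T where "T = p1 * dagger p2 - p2 * dagger p1"
  have "on_axis T x = 0" if "x \<in> extremal_points \<omega> s q" for x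
  proof -
    define A1 B1 A2 B2 where "A1 = Re (rotated \<omega> p1 x)" and "B1 = Im (rotated \<omega> p1 x)"
      and "A2 = Re (rotated \<omega> p2 x)" and "B2 = Im (rotated \<omega> p2 x)"
    have x: "x \<in> {-1..1}" using that by (simp add: extremal_points_def)
    have hp: "rotated \<omega> p x = of_real (Re (on_axis h x)) * rotated \<omega> q x"
      using on_axis_selfdual_real[OF hq(2), of x] by (simp add: hq(1) rotated_def mult_ac)
    have "x \<in> extremal_points \<omega> s p"
      using that unfolding extremal_points_def mem_Collect_eq hp norm_mult Im_of_real_mult abs_mult by simp
    then have eq: "?c * \<bar>B1 + B2\<bar> = s * (A1 + A2)"
      using extremal_points_iff_cone[OF s0 s1 x posp[OF x]]
      by (simp add: p_def rotated_add A1_def A2_def B1_def B2_def)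
    have le: "?c * \<bar>B1\<bar> \<le> s * A1" "?c * \<bar>B2\<bar> \<le> s * A2"
      using cone[OF x] by (simp_all add: A1_def A2_def B1_def B2_def)
    define \<sigma> where "\<sigma> = (if B1 + B2 \<ge> 0 then 1 else (-1::real))"
    have le': "?c * (\<sigma> * B1) \<le> ?c * \<bar>B1\<bar>" "?c * (\<sigma> * B2) \<le> ?c * \<bar>B2\<bar>"
      using c0 by (auto simp: \<sigma>_def)
    have eq': "?c * (\<sigma> * B1) + ?c * (\<sigma> * B2) = s * A1 + s * A2"
      using eq by (auto simp: \<sigma>_def algebra_simps abs_if split: if_splits)
    have e: "?c * (\<sigma> * B1) = s * A1" "?c * (\<sigma> * B2) = s * A2"
      using eq' le le' by linarith+
    have "(?c * \<sigma>) * (B1 * A2) = (?c * (\<sigma> * B1)) * A2" by (simp only: mult_ac)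
    also have "\<dots> = (?c * (\<sigma> * B2)) * A1" unfolding e by (simp only: mult_ac)
    also have "\<dots> = (?c * \<sigma>) * (B2 * A1)" by (simp only: mult_ac)
    finally have "B1 * A2 = B2 * A1" using c0 by (auto simp: \<sigma>_def split: if_splits)
    then have im: "Im (rotated \<omega> p1 x * cnj (rotated \<omega> p2 x)) = 0"
      by (simp add: A1_def A2_def B1_def B2_def algebra_simps)
    have "on_axis T x = rotated \<omega> p1 x * cnj (rotated \<omega> p2 x) - cnj (rotated \<omega> p1 x * cnj (rotated \<omega> p2 x))"
      unfolding rotated_mult_cnj T_def by (simp add: on_axis_dagger)
    then show ?thesis unfolding complex_diff_cnj im by simp
  qed
  then have sub: "(\<lambda>x. \<i> * of_real x) ` extremal_points \<omega> s q \<subseteq> {z. poly T z = 0}" by auto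
  have "T = 0"
  proof (rule ccontr)
    assume "T \<noteq> 0"
    have "card (extremal_points \<omega> s q) = card ((\<lambda>x::real. \<i> * of_real x) ` extremal_points \<omega> s q)"
      by (rule card_image[symmetric]) (auto simp: inj_on_def)
    also have "\<dots> \<le> card {z. poly T z = 0}"
      using sub poly_roots_finite[OF \<open>T \<noteq> 0\<close>] by (intro card_mono)
    also have "\<dots> \<le> degree T" using \<open>T \<noteq> 0\<close> by (rule card_poly_roots_bound)
    also have "\<dots> \<le> 2 * n"
      unfolding T_def using deg degree_mult_le[of p1 "dagger p2"] degree_mult_le[of p2 "dagger p1"]
      by (intro degree_diff_le) auto
    finally show False using count(4) by simp
  qed
  then show ?thesis by (simp add: T_def mult.commute)
qed

lemma optimal_unique:
  assumes "sine_optimal n \<omega> s p1" "sine_optimal n \<omega> s p2" "reduced p1" "reduced p2" "\<omega> \<noteq> 0" "s < 1"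
  shows "dagger p1 * p2 = dagger p2 * p1"
proof -
  have *: "\<exists>p'. (p' = p \<or> p' = - p) \<and> sine_optimal n \<omega> s p' \<and> (\<forall>y\<in>{-1..1}. Re (rotated \<omega> p' y) > 0)"
    if "sine_optimal n \<omega> s p" "reduced p" for p
  proof -
    have "sine_bounded \<omega> s p" using that(1) by (simp add: sine_optimal_def)
    from rotated_real_part_sign[OF that(2) this assms(6)] show ?thesis
    proof
      assume "\<forall>x\<in>{-1..1}. Re (rotated \<omega> p x) > 0"
      then show ?thesis using that(1) by blast
    next
      assume "\<forall>x\<in>{-1..1}. Re (rotated \<omega> p x) < 0"
      then show ?thesis using that(1) by (intro exI[of _ "- p"]) (simp add: sine_optimal_uminus rotated_uminus)
    qed
  qed
  obtain p1' where p1': "p1' = p1 \<or> p1' = - p1" "sine_optimal n \<omega> s p1'"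
     "\<forall>y\<in>{-1..1}. Re (rotated \<omega> p1' y) > 0" using *[OF assms(1,3)] by blast
  obtain p2' where p2': "p2' = p2 \<or> p2' = - p2" "sine_optimal n \<omega> s p2'"
     "\<forall>y\<in>{-1..1}. Re (rotated \<omega> p2' y) > 0" using *[OF assms(2,4)] by blast
  have "dagger p1' * p2' = dagger p2' * p1'"
    using optimal_unique_pos[OF p1'(2) p2'(2) assms(5,6)] p1'(3) p2'(3) by blast
  then show ?thesis using p1'(1) p2'(1) by (auto simp: dagger_uminus)
qed

lemma optimal_imp_best_approx:
  assumes "sine_optimal n \<omega> s p"
  shows "is_unitary_best_approx n \<omega> (Fract (dagger p) p)"
  unfolding is_unitary_best_approx_def
proof (intro conjI ballI)
  have p: "p \<noteq> 0" "degree p \<le> n" "sine_bounded \<omega> s p" using assms by (auto simp: sine_optimal_def)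
  then show "Fract (dagger p) p \<in> unitary_rationals n" by (auto simp: unitary_rationals_def)
  fix u assume "u \<in> unitary_rationals n"
  then obtain q where q: "u = Fract (dagger q) q" "degree q \<le> n" "q \<noteq> 0"
    by (auto simp: unitary_rationals_def)
  then have "sine_bounded \<omega> (approx_error \<omega> u / 2) q"
    using approx_error_le_iff[of q \<omega> "approx_error \<omega> u / 2"] by simp
  then have "s \<le> approx_error \<omega> u / 2" using assms q(2,3) unfolding sine_optimal_def by blast
  moreover have "approx_error \<omega> (Fract (dagger p) p) \<le> 2 * s"
    using approx_error_le_iff[OF p(1)] p(3) by simp
  ultimately show "approx_error \<omega> (Fract (dagger p) p) \<le> approx_error \<omega> u" by linarith
qed

lemma best_approx_imp_optimal:
  assumes "is_unitary_best_approx n \<omega> r"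
  obtains s p where "reduced p" "sine_optimal n \<omega> s p" "r = Fract (dagger p) p"
proof -
  obtain q where q: "r = Fract (dagger q) q" "degree q \<le> n" "q \<noteq> 0"
    using assms by (auto simp: is_unitary_best_approx_def unitary_rationals_def)
  define s where "s = approx_error \<omega> r / 2"
  have "sine_optimal n \<omega> s q"
    unfolding sine_optimal_def
  proof (intro conjI allI impI)
    show "sine_bounded \<omega> s q" using approx_error_le_iff[OF q(3), of \<omega> s] q(1) by (simp add: s_def)
    fix q' s' assume q': "q' \<noteq> 0 \<and> degree q' \<le> n \<and> sine_bounded \<omega> s' q'"
    then have "Fract (dagger q') q' \<in> unitary_rationals n" by (auto simp: unitary_rationals_def)
    then have "approx_error \<omega> r \<le> approx_error \<omega> (Fract (dagger q') q')"
      using assms by (auto simp: is_unitary_best_approx_def)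
    also have "\<dots> \<le> 2 * s'" using approx_error_le_iff[of q'] q' by simp
    finally show "s \<le> s'" by (simp add: s_def)
  qed (use q in auto)
  moreover obtain h p where hp: "q = h * p" "dagger h = h" "h \<noteq> 0" "reduced p"
    using reduced_decomposition[OF q(3)] .
  ultimately have "sine_optimal n \<omega> s p" using sine_optimal_reduced_factor by blast
  moreover have "r = Fract (dagger p) p"
    using Fract_selfdual_factor[OF hp(2,3), of p] hp q(1) by (simp add: reduced_def)
  ultimately show ?thesis using that hp(4) by blast
qed

text \<open>
  Existence and uniqueness of the best approximation, in the form in which the
  definite description is used from here on.
\<close>

lemma unitary_best_approx_optimal:
  assumes "0 < \<omega>" "\<omega> < (real n + 1) * pi"
  obtains s p where "reduced p" "sine_optimal n \<omega> s p" "s < 1"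
    "unitary_best_approx n \<omega> = Fract (dagger p) p"
proof -
  obtain s p0 where "sine_optimal n \<omega> s p0" using sine_optimal_exists by blast
  then obtain s p where p: "reduced p" "sine_optimal n \<omega> s p"
    using best_approx_imp_optimal[OF optimal_imp_best_approx] by metis
  obtain p1 s1 where "p1 \<noteq> 0" "degree p1 \<le> n" "sine_bounded \<omega> s1 p1" "s1 < 1"
    using sine_bound_less_one_exists[OF assms] by blast
  then have s1: "s < 1" using p(2) unfolding sine_optimal_def by force
  have "unitary_best_approx n \<omega> = Fract (dagger p) p"
    unfolding unitary_best_approx_def
  proof (rule the_equality)
    show "is_unitary_best_approx n \<omega> (Fract (dagger p) p)" by (rule optimal_imp_best_approx[OF p(2)])
    fix r assume "is_unitary_best_approx n \<omega> r"
    then obtain s' p' where p': "reduced p'" "sine_optimal n \<omega> s' p'" "r = Fract (dagger p') p'"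
      using best_approx_imp_optimal by blast
    have "s' = s" using p(2) p'(2) unfolding sine_optimal_def by (meson antisym)
    then have "dagger p' * p = dagger p * p'"
      using optimal_unique[of n \<omega> s p' p] p p' s1 assms(1) by simp
    then show "r = Fract (dagger p) p"
      using p(1) p'(1) unfolding p'(3) by (simp add: eq_fract reduced_def)
  qed
  with p s1 show ?thesis using that by blast
qed

section \<open>Convergence of the poles\<close>

lemma sine_bounded_mono:
  assumes "sine_bounded \<omega> s p" "s \<le> s'" shows "sine_bounded \<omega> s' p"
  using assms unfolding sine_bounded_def
  by (meson mult_right_mono norm_ge_zero order_trans)

lemma norm_cis_diff_le: "cmod (cis a - cis b) \<le> \<bar>a - b\<bar>"
proof -
  have "cis a - cis b = cis b * (cis (a - b) - 1)" by (simp add: algebra_simps cis_mult)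
  then have "cmod (cis a - cis b) = cmod (exp (\<i> * of_real (a - b)) - 1)"
    by (simp add: norm_mult cis_conv_exp)
  also have "\<dots> = 2 * \<bar>sin ((a - b) / 2)\<bar>"
    using dist_exp_i_1[of "a - b"] by (simp add: dist_norm)
  also have "\<dots> \<le> \<bar>a - b\<bar>" using abs_sin_x_le_abs_x[of "(a - b) / 2"] by simp
  finally show ?thesis .
qed

text \<open>
  The exponential is Lipschitz in \<open>\<omega>\<close>. This yields an upper bound for the optimal error at nearby
  frequencies, which makes limits of optimal denominators optimal.
\<close>

lemma sine_bounded_frequency_shift:
  assumes "sine_bounded \<omega> s p"
  shows "sine_bounded \<omega>' (s + \<bar>\<omega>' - \<omega>\<bar> / 2) p"
  unfolding sine_bounded_def
proof
  fix x :: real assume x: "x \<in> {-1..1}"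
  have "cmod (rotated \<omega>' p x - rotated \<omega> p x) = cmod (on_axis p x) * cmod (cis (\<omega>' * x / 2) - cis (\<omega> * x / 2))"
    by (simp add: rotated_def flip: right_diff_distrib norm_mult)
  also have "\<dots> \<le> cmod (on_axis p x) * (\<bar>\<omega>' - \<omega>\<bar> / 2)"
  proof (intro mult_left_mono)
    have "\<bar>\<omega>' * x / 2 - \<omega> * x / 2\<bar> = \<bar>\<omega>' - \<omega>\<bar> / 2 * \<bar>x\<bar>"
      by (simp add: abs_mult flip: left_diff_distrib diff_divide_distrib)
    also have "\<dots> \<le> \<bar>\<omega>' - \<omega>\<bar> / 2 * 1" using x by (intro mult_left_mono) auto
    finally show "cmod (cis (\<omega>' * x / 2) - cis (\<omega> * x / 2)) \<le> \<bar>\<omega>' - \<omega>\<bar> / 2"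
      using norm_cis_diff_le[of "\<omega>' * x / 2" "\<omega> * x / 2"] by linarith
  qed simp
  finally have "\<bar>Im (rotated \<omega>' p x - rotated \<omega> p x)\<bar> \<le> cmod (on_axis p x) * (\<bar>\<omega>' - \<omega>\<bar> / 2)"
    using abs_Im_le_cmod order_trans by blast
  moreover have "\<bar>Im (rotated \<omega> p x)\<bar> \<le> s * cmod (on_axis p x)"
    using assms x by (simp add: sine_bounded_def)
  moreover have "\<bar>Im (rotated \<omega>' p x)\<bar> \<le> \<bar>Im (rotated \<omega> p x)\<bar> + \<bar>Im (rotated \<omega>' p x - rotated \<omega> p x)\<bar>"
    by simp
  ultimately have "\<bar>Im (rotated \<omega>' p x)\<bar> \<le> s * cmod (on_axis p x) + cmod (on_axis p x) * (\<bar>\<omega>' - \<omega>\<bar> / 2)"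
    by linarith
  then show "\<bar>Im (rotated \<omega>' p x)\<bar> \<le> (s + \<bar>\<omega>' - \<omega>\<bar> / 2) * cmod (on_axis p x)"
    by (simp only: distrib_right mult.commute[of "cmod (on_axis p x)"])
qed

text \<open>
  A polynomial is large wherever all its zeros are far away. For a fixed degree and leading
  coefficients bounded away from zero this is a quantitative form of the continuity of zeros.
\<close>

lemma poly_lower_bound_root_distance:
  fixes q :: "complex poly"
  assumes "\<And>z. poly q z = 0 \<Longrightarrow> e \<le> dist z t" "e > 0"
  shows "cmod (lead_coeff q) * e ^ degree q \<le> cmod (poly q t)"
proof (cases "q = 0")
  case False
  obtain root where r: "smult (lead_coeff q) (\<Prod>i<degree q. [:- root i, 1:]) = q"
    using complex_poly_decompose' .
  have root: "poly q (root i) = 0" if "i < degree q" for i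
    by (subst r[symmetric]) (use that in \<open>auto simp: poly_prod\<close>)
  have "poly q t = lead_coeff q * (\<Prod>i<degree q. t - root i)"
    by (subst r[symmetric]) (simp add: poly_prod)
  then have "cmod (poly q t) = cmod (lead_coeff q) * (\<Prod>i<degree q. dist (root i) t)"
    by (simp add: norm_mult prod_norm[symmetric] dist_norm norm_minus_commute)
  moreover have "(\<Prod>i<degree q. e) \<le> (\<Prod>i<degree q. dist (root i) t)"
    using assms root by (intro prod_mono) auto
  ultimately show ?thesis by (simp add: mult_left_mono)
qed simp

text \<open>
  Assign to each limit point the nearest point of \<open>Z k\<close>. For large \<open>k\<close> this is injective, hence
  exhausts \<open>Z k\<close>; for the finitely many other \<open>k\<close> any numbering will do.
\<close>

lemma convergent_numbering:
  fixes Z :: "nat \<Rightarrow> complex set" and t :: "nat \<Rightarrow> complex"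
  assumes fin: "\<And>k. finite (Z k)" and card: "\<And>k. card (Z k) = n" and inj: "inj_on t {..<n}"
    and near: "\<And>i e. i < n \<Longrightarrow> e > 0 \<Longrightarrow> \<forall>\<^sub>F k in sequentially. \<exists>z\<in>Z k. dist z (t i) < e"
  shows "\<exists>s. (\<forall>k. bij_betw (s k) {..<n} (Z k)) \<and> (\<forall>i<n. (\<lambda>k. s k i) \<longlonglongrightarrow> t i)"
proof -
  define c where "c k i = arg_min_on (\<lambda>z. dist z (t i)) (Z k)" for k i
  have ne: "Z k \<noteq> {}" if "i < n" for k i using card[of k] that by auto
  have cZ: "c k i \<in> Z k" if "i < n" for k i
    unfolding c_def using fin ne[OF that] by (rule arg_min_if_finite(1))
  have clim: "(\<lambda>k. c k i) \<longlonglongrightarrow> t i" if i: "i < n" for i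
  proof (rule tendstoI)
    fix e :: real assume "e > 0"
    from near[OF i this] show "\<forall>\<^sub>F k in sequentially. dist (c k i) (t i) < e"
    proof eventually_elim
      case (elim k)
      then obtain z where "z \<in> Z k" "dist z (t i) < e" by blast
      moreover have "dist (c k i) (t i) \<le> dist z (t i)"
        unfolding c_def using arg_min_least[OF fin ne[OF i] \<open>z \<in> Z k\<close>] .
      ultimately show ?case by simp
    qed
  qed
  have "\<forall>\<^sub>F k in sequentially. c k i \<noteq> c k j" if "i < n" "j < n" "i \<noteq> j" for i j
  proof -
    have "(\<lambda>k. c k i - c k j) \<longlonglongrightarrow> t i - t j" using clim that by (intro tendsto_diff) auto
    moreover have "t i - t j \<noteq> 0" using inj that by (auto simp: inj_on_def)
    ultimately have "\<forall>\<^sub>F k in sequentially. c k i - c k j \<noteq> 0" by (rule tendsto_imp_eventually_ne)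
    then show ?thesis by simp
  qed
  then have "\<forall>\<^sub>F k in sequentially. \<forall>i\<in>{..<n}. \<forall>j\<in>{..<n}. i \<noteq> j \<longrightarrow> c k i \<noteq> c k j"
    by (auto intro!: eventually_ball_finite)
  then have ev: "\<forall>\<^sub>F k in sequentially. inj_on (c k) {..<n}"
    by eventually_elim (auto simp: inj_on_def)
  have "\<exists>b. bij_betw b {..<n} (Z k)" for k
    using ex_bij_betw_nat_finite[OF fin[of k]] card[of k] by (simp add: atLeast0LessThan)
  then obtain b where b: "\<And>k. bij_betw (b k) {..<n} (Z k)" by metis
  define s where "s k = (if inj_on (c k) {..<n} then c k else b k)" for k
  have "bij_betw (s k) {..<n} (Z k)" for k
  proof (cases "inj_on (c k) {..<n}")
    case True
    have "c k ` {..<n} = Z k"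
      by (rule card_subset_eq[OF fin]) (use cZ True card in \<open>auto simp: card_image\<close>)
    then show ?thesis using True by (simp add: s_def bij_betw_def)
  next
    case False then show ?thesis using b by (simp add: s_def)
  qed
  moreover have "(\<lambda>k. s k i) \<longlonglongrightarrow> t i" if "i < n" for i
  proof (rule Lim_transform_eventually[OF clim[OF that]])
    show "\<forall>\<^sub>F k in sequentially. c k i = s k i" using ev by eventually_elim (simp add: s_def)
  qed
  ultimately show ?thesis by blast
qed

text \<open>
  Cancelling from \<open>q\<close> its factor fixed by the involution leaves an optimal denominator, a multiple of \<open>p\<close> by
  uniqueness; as \<open>p\<close> already has the full degree \<open>n\<close>, there is no room for a further factor.
\<close>

lemma optimal_denominator_unique:
  assumes "sine_optimal n \<omega> s p" "reduced p" "\<omega> \<noteq> 0" "s < 1"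
    and "q \<noteq> 0" "degree q \<le> n" "sine_bounded \<omega> s q"
  obtains c where "q = smult c p" "c \<noteq> 0"
proof -
  have "sine_optimal n \<omega> s q" using assms by (auto simp: sine_optimal_def)
  moreover obtain h q0 where h: "q = h * q0" "dagger h = h" "h \<noteq> 0" "reduced q0"
    using reduced_decomposition[OF assms(5)] .
  ultimately have "sine_optimal n \<omega> s q0" using sine_optimal_reduced_factor by blast
  then have "dagger p * q0 = dagger q0 * p" using optimal_unique assms h(4) by blast
  then have "p dvd q0"
    using assms(2) unfolding reduced_def by (metis coprime_dvd_mult_right_iff dvd_triv_right)
  then have "p dvd q" using h(1) by simp
  moreover have "degree q \<le> degree p" using optimal_extremal_count(1)[OF assms(1-4)] assms(6) by simp
  ultimately show ?thesis using assms(5) that by (rule dvd_same_degree_imp_smult)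
qed

text \<open>
  Otherwise a subsequence of the denominators has no zeros within distance \<open>e\<close> of \<open>t\<close>. A further
  subsequence converges, after scaling, to a multiple of \<open>p\<^sub>a\<close>, which vanishes at \<open>t\<close>; since no degree
  is lost in the limit, the lower bound by the distance to the zeros is violated.
\<close>

lemma optimal_roots_approach:
  fixes \<omega> :: "nat \<Rightarrow> real"
  assumes opt: "\<And>k. sine_optimal n (\<omega> k) (s k) (p k)" and degn: "\<And>k. degree (p k) = n"
    and lim: "\<omega> \<longlonglongrightarrow> \<omega>\<^sub>a"
    and opta: "sine_optimal n \<omega>\<^sub>a s\<^sub>a p\<^sub>a" "reduced p\<^sub>a" "\<omega>\<^sub>a \<noteq> 0" "s\<^sub>a < 1"
    and t: "poly p\<^sub>a t = 0" and e: "e > 0"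
  shows "\<forall>\<^sub>F k in sequentially. \<exists>z\<in>{z. poly (p k) z = 0}. dist z t < e"
proof (rule ccontr)
  assume "\<not> ?thesis"
  from not_eventually_sequentiallyD[OF this]
  obtain g :: "nat \<Rightarrow> nat" where g: "strict_mono g" "\<forall>k. \<not> (\<exists>z\<in>{z. poly (p (g k)) z = 0}. dist z t < e)" by blast
  then have far: "\<And>k z. poly (p (g k)) z = 0 \<Longrightarrow> e \<le> dist z t" by (auto simp: not_less)
  \<comment> \<open>Bounds for the optimal errors: the denominator \<open>p\<^sub>a\<close> is a competitor for each frequency.\<close>
  define S where "S k = s\<^sub>a + \<bar>\<omega> (g k) - \<omega>\<^sub>a\<bar> / 2" for k
  have pa: "p\<^sub>a \<noteq> 0" "degree p\<^sub>a = n" "sine_bounded \<omega>\<^sub>a s\<^sub>a p\<^sub>a"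
    using opta(1) optimal_extremal_count(1)[OF opta] by (auto simp: sine_optimal_def)
  have bd: "sine_bounded (\<omega> (g k)) (S k) (p (g k))" for k
  proof -
    have "sine_bounded (\<omega> (g k)) (S k) p\<^sub>a"
      unfolding S_def by (rule sine_bounded_frequency_shift[OF pa(3)])
    then have "s (g k) \<le> S k" using opt[of "g k"] pa by (auto simp: sine_optimal_def)
    then show ?thesis using opt[of "g k"] sine_bounded_mono by (auto simp: sine_optimal_def)
  qed
  have wg: "(\<lambda>k. \<omega> (g k)) \<longlonglongrightarrow> \<omega>\<^sub>a" using LIMSEQ_subseq_LIMSEQ[OF lim g(1)] by (simp add: o_def)
  have "S \<longlonglongrightarrow> s\<^sub>a + \<bar>\<omega>\<^sub>a - \<omega>\<^sub>a\<bar> / 2" unfolding S_def by (intro tendsto_intros wg) simp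
  then have Slim: "S \<longlonglongrightarrow> s\<^sub>a" by simp
  have dg: "degree (p (g k)) \<le> n" for k using degn by simp
  have p0: "p (g k) \<noteq> 0" for k using opt by (simp add: sine_optimal_def)
  obtain f c q where f: "strict_mono f" "\<And>k. c k > (0::real)" "q \<noteq> 0" "degree q \<le> n"
    "\<And>i. (\<lambda>k. coeff (smult (of_real (c k)) (p (g (f k)))) i) \<longlonglongrightarrow> coeff q i"
    "sine_bounded \<omega>\<^sub>a s\<^sub>a q"
    by (rule sine_bounded_compactness[of "\<lambda>k. p (g k)" n, OF dg p0 bd wg Slim])
       (rule that; assumption)
  obtain d where d: "q = smult d p\<^sub>a" "d \<noteq> 0"
    using optimal_denominator_unique[OF opta f(3,4,6)] .
  define u where "u k = smult (of_real (c k)) (p (g (f k)))" for k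
  have du: "degree (u k) = n" for k using f(2)[of k] degn by (simp add: u_def)
  have ulim: "(\<lambda>k. poly (u k) t) \<longlonglongrightarrow> poly q t"
    using f(5) du f(4) unfolding u_def by (intro poly_tendsto_coeffwise) auto
  have "cmod (coeff (u k) n) * e ^ n \<le> cmod (poly (u k) t)" for k
  proof -
    have "e \<le> dist z t" if "poly (u k) z = 0" for z
      using that far f(2)[of k] by (auto simp: u_def)
    from poly_lower_bound_root_distance[OF this e, of "u k"] show ?thesis by (simp add: du)
  qed
  moreover have "(\<lambda>k. cmod (coeff (u k) n) * e ^ n) \<longlonglongrightarrow> cmod (coeff q n) * e ^ n"
    using f(5) unfolding u_def by (intro tendsto_intros)
  moreover have "(\<lambda>k. cmod (poly (u k) t)) \<longlonglongrightarrow> cmod (poly q t)" by (intro tendsto_intros ulim)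
  ultimately have "cmod (coeff q n) * e ^ n \<le> cmod (poly q t)"
    by (meson LIMSEQ_le)
  moreover have "poly q t = 0" using d t by simp
  moreover have "coeff q n \<noteq> 0" using d pa by (metis degree_smult_eq leading_coeff_0_iff f(3))
  moreover have "e ^ n > 0" using e by simp
  ultimately show False by (simp add: mult_le_0_iff)
qed

theorem proposition7p2:
  fixes n :: nat and \<omega> :: "nat \<Rightarrow> real" and \<omega>\<^sub>a :: real
  assumes "n \<ge> 1"
    and "\<And>k. \<omega> k \<in> {0<..<(real n + 1) * pi}"
    and "\<omega>\<^sub>a \<in> {0<..<(real n + 1) * pi}"
    and "\<omega> \<longlonglongrightarrow> \<omega>\<^sub>a"
  shows "\<exists>(s :: nat \<Rightarrow> nat \<Rightarrow> complex) (t :: nat \<Rightarrow> complex).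
           (\<forall>k. bij_betw (s k) {..<n} (poles (unitary_best_approx n (\<omega> k)))) \<and>
           bij_betw t {..<n} (poles (unitary_best_approx n \<omega>\<^sub>a)) \<and>
           (\<forall>i<n. (\<lambda>k. s k i) \<longlonglongrightarrow> t i)"
proof -
  have "\<exists>s p. reduced p \<and> sine_optimal n w s p \<and> s < 1 \<and> unitary_best_approx n w = Fract (dagger p) p"
    if "w \<in> {0<..<(real n + 1) * pi}" for w
    using unitary_best_approx_optimal[of w n] that by (metis greaterThanLessThan_iff)
  note rep = this
  then have "\<forall>k. \<exists>s p. reduced p \<and> sine_optimal n (\<omega> k) s p \<and> s < 1 \<and>
      unitary_best_approx n (\<omega> k) = Fract (dagger p) p" using assms(2) by blast
  then obtain \<delta> p where p: "\<And>k. reduced (p k)" "\<And>k. sine_optimal n (\<omega> k) (\<delta> k) (p k)" "\<And>k. \<delta> k < 1"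
    "\<And>k. unitary_best_approx n (\<omega> k) = Fract (dagger (p k)) (p k)" by metis
  obtain \<delta>\<^sub>a p\<^sub>a where pa: "reduced p\<^sub>a" "sine_optimal n \<omega>\<^sub>a \<delta>\<^sub>a p\<^sub>a" "\<delta>\<^sub>a < 1"
    "unitary_best_approx n \<omega>\<^sub>a = Fract (dagger p\<^sub>a) p\<^sub>a" using rep[OF assms(3)] by blast
  have w: "\<omega> k \<noteq> 0" "\<omega>\<^sub>a \<noteq> 0" for k using assms(2)[of k] assms(3) by auto
  note count = optimal_extremal_count(1,2)[OF p(2,1) w(1) p(3)]
  note counta = optimal_extremal_count(1,2)[OF pa(2,1) w(2) pa(3)]
  define Z where "Z k = {z. poly (p k) z = 0}" for k
  have fin: "finite {z. poly p z = 0}" if "reduced p" for p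
    using that poly_roots_finite by (auto simp: reduced_def)
  obtain t where t: "bij_betw t {..<n} {z. poly p\<^sub>a z = 0}"
    using ex_bij_betw_nat_finite[OF fin[OF pa(1)]] counta(2) by (auto simp: atLeast0LessThan)
  have "\<exists>s. (\<forall>k. bij_betw (s k) {..<n} (Z k)) \<and> (\<forall>i<n. (\<lambda>k. s k i) \<longlonglongrightarrow> t i)"
  proof (rule convergent_numbering)
    show "finite (Z k)" "card (Z k) = n" for k using fin[OF p(1)] count(2) by (auto simp: Z_def)
    show "inj_on t {..<n}" using t by (rule bij_betw_imp_inj_on)
    fix i and e :: real assume "i < n" "e > 0"
    then have "poly p\<^sub>a (t i) = 0" using bij_betwE[OF t] by auto
    from optimal_roots_approach[OF p(2) count(1) assms(4) pa(2,1) w(2) pa(3) this \<open>e > 0\<close>]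
    show "\<forall>\<^sub>F k in sequentially. \<exists>z\<in>Z k. dist z (t i) < e" by (simp add: Z_def)
  qed
  then show ?thesis using t poles_reduced[OF p(1)] poles_reduced[OF pa(1)]
    unfolding p(4) pa(4) Z_def by auto
qed

end
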